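(* Let $q\neq 1$ (with $q$ real and nonzero) and let $s=\imath t$ where $t\neq 0$ is real. The patch in the Podleś $2$-sphere with parameters $q^2$ and $s^2=-t^2$ where one adjoins $x^{-1}$ is isomorphic to the algebra $U_q(su_2)$ modulo the relation $c_q=t+t^{-1}$.
   Context: Podleś sphere with real parameters $q^2\neq0$ and $s^2$: the unital complex $*$-algebra with generators $x=x^*,z,z^*$ and relations $zx=q^2xz$, $zz^*=(s^2+q^2x)(1-q^2x)$, $z^*z=(s^2+x)(1-x)$. $U_q(su_2)$ (the formulas require $q-q^{-1}\neq 0$): the unital complex $*$-algebra with generators $x_+,x_-,K,K^{-1}$ and relations $KK^{-1}=K^{-1}K=1$, $Kx_\pm K^{-1}=q^{\pm1}x_\pm$, $[x_+,x_-]=\dfrac{K^2-K^{-2}}{q-q^{-1}}$, and $K^*=K$, $x_\pm^*=x_\mp$ for real $q$. Its $q$-deformed quadratic Casimir is $$c_q=K^2q^{-1}+qK^{-2}+x_+x_-(q-q^{-1})^2 .$$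
   Formalization: As printed this is false (for t=q the quotient has two characters, the patch one); the target is instead the subalgebra of U_q(su_2)/(c_q=t+1/t) generated by products of two generators, with q≠-1 as well; the isomorphism is one of algebras, and of *-algebras when q>0. *)

theory Defs
  imports
    Complex_Main
    "HOL-Library.Poly_Mapping"
    "HOL-Algebra.QuotRing"
    "HOL-Algebra.Generated_Rings"
    "HOL-Algebra.Module"
begin

section \<open>The free unital complex *-algebra\<close>

datatype 'g word = Word "'g list"

instantiation word :: (type) monoid_add
begin

definition zero_word :: "'a word" where "zero_word = Word []"

fun plus_word :: "'a word \<Rightarrow> 'a word \<Rightarrow> 'a word" where
  "plus_word (Word u) (Word v) = Word (u @ v)"

instance
proof
  fix a b c :: "'a word"
  show "a + b + c = a + (b + c)" by (cases a; cases b; cases c) simp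
  show "0 + a = a" by (cases a) (simp add: zero_word_def)
  show "a + 0 = a" by (cases a) (simp add: zero_word_def)
qed

end

text \<open>Words form the free monoid, written additively, so the convolution product that
  \<^theory>\<open>HOL-Library.Poly_Mapping\<close> puts on the type below is the product of the free algebra.\<close>

type_synonym 'g free = "'g word \<Rightarrow>\<^sub>0 complex"

definition scalar :: "complex \<Rightarrow> 'g free" where
  "scalar c = Poly_Mapping.single 0 c"

abbreviation rscalar :: "real \<Rightarrow> 'g free" where
  "rscalar r \<equiv> scalar (complex_of_real r)"

definition gen :: "'g \<Rightarrow> 'g free" where
  "gen g = Poly_Mapping.single (Word [g]) 1"

fun adj_word :: "('g \<Rightarrow> 'g) \<Rightarrow> 'g word \<Rightarrow> 'g word" where
  "adj_word bar (Word w) = Word (rev (map bar w))"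

text \<open>The antilinear, antimultiplicative extension of a map \<open>bar\<close> on the generators.\<close>

definition adj :: "('g \<Rightarrow> 'g) \<Rightarrow> 'g free \<Rightarrow> 'g free" where
  "adj bar p = (\<Sum>w\<in>Poly_Mapping.keys p.
      Poly_Mapping.single (adj_word bar w) (cnj (Poly_Mapping.lookup p w)))"

definition free_ring :: "'g free ring" where
  "free_ring = \<lparr>carrier = UNIV, mult = (*), one = 1, zero = 0, add = (+)\<rparr>"


section \<open>*-algebras given by generators and relations\<close>

record 'a star_algebra = "(complex, 'a) module" +
  star :: "'a \<Rightarrow> 'a"

text \<open>The two-sided *-ideal generated by \<open>R\<close>; adding the adjoint relations makes the
  involution descend to the quotient.\<close>

definition star_ideal :: "('g \<Rightarrow> 'g) \<Rightarrow> 'g free set \<Rightarrow> 'g free set" where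
  "star_ideal bar R = genideal free_ring (R \<union> adj bar ` R)"

definition cls :: "('g \<Rightarrow> 'g) \<Rightarrow> 'g free set \<Rightarrow> 'g free \<Rightarrow> 'g free set" where
  "cls bar R p = star_ideal bar R +>\<^bsub>free_ring\<^esub> p"

definition presented :: "('g \<Rightarrow> 'g) \<Rightarrow> 'g free set \<Rightarrow> 'g free set star_algebra" where
  "presented bar R = (let Q = free_ring Quot star_ideal bar R in
     \<lparr>carrier = carrier Q, mult = mult Q, one = one Q, zero = zero Q, add = add Q,
      smult = (\<lambda>c X. cls bar R (scalar c) \<otimes>\<^bsub>Q\<^esub> X),
      star = (\<lambda>X. adj bar ` X)\<rparr>)"

definition alg_iso ::
  "('a, 'm) star_algebra_scheme \<Rightarrow> ('b, 'n) star_algebra_scheme \<Rightarrow> ('a \<Rightarrow> 'b) set" where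
  "alg_iso A B = {f \<in> ring_iso A B.
     \<forall>c. \<forall>a \<in> carrier A. f (c \<odot>\<^bsub>A\<^esub> a) = c \<odot>\<^bsub>B\<^esub> f a}"

definition star_alg_iso ::
  "('a, 'm) star_algebra_scheme \<Rightarrow> ('b, 'n) star_algebra_scheme \<Rightarrow> ('a \<Rightarrow> 'b) set" where
  "star_alg_iso A B = {f \<in> alg_iso A B. \<forall>a \<in> carrier A. f (star A a) = star B (f a)}"

text \<open>The unital subalgebra generated by the products of two generators. If all the relations
  are of even degree modulo 2, this is the fixed point algebra of the automorphism that
  negates every generator.\<close>

definition even_part :: "('g \<Rightarrow> 'g) \<Rightarrow> 'g free set \<Rightarrow> 'g free set star_algebra" where
  "even_part bar R = (presented bar R)\<lparr>carrier :=
     generate_ring (presented bar R)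
       (range (\<lambda>c. cls bar R (scalar c)) \<union> {cls bar R (gen g * gen h) |g h. True})\<rparr>"


section \<open>The Podle\'s sphere and its patch\<close>

text \<open>\<open>Q\<close> and \<open>S\<close> stand for the parameters usually written \<open>q\<^sup>2\<close> and \<open>s\<^sup>2\<close>; \<open>S\<close> may be negative.\<close>

definition podles_rels ::
  "real \<Rightarrow> real \<Rightarrow> 'g free \<Rightarrow> 'g free \<Rightarrow> 'g free \<Rightarrow> 'g free set" where
  "podles_rels Q S x z zs =
    {z * x - rscalar Q * x * z,
     z * zs - (rscalar S + rscalar Q * x) * (1 - rscalar Q * x),
     zs * z - (rscalar S + x) * (1 - x)}"

datatype podles_gen = PX | PZ | PZstar

fun podles_bar :: "podles_gen \<Rightarrow> podles_gen" where
  "podles_bar PX = PX"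
| "podles_bar PZ = PZstar"
| "podles_bar PZstar = PZ"

definition podles_sphere :: "real \<Rightarrow> real \<Rightarrow> podles_gen free set star_algebra" where
  "podles_sphere Q S = presented podles_bar (podles_rels Q S (gen PX) (gen PZ) (gen PZstar))"

datatype patch_gen = TX | TXinv | TZ | TZstar

fun patch_bar :: "patch_gen \<Rightarrow> patch_gen" where
  "patch_bar TX = TX"
| "patch_bar TXinv = TXinv"
| "patch_bar TZ = TZstar"
| "patch_bar TZstar = TZ"

definition patch_rels :: "real \<Rightarrow> real \<Rightarrow> patch_gen free set" where
  "patch_rels Q S = podles_rels Q S (gen TX) (gen TZ) (gen TZstar) \<union>
     {gen TX * gen TXinv - 1, gen TXinv * gen TX - 1}"

definition podles_patch :: "real \<Rightarrow> real \<Rightarrow> patch_gen free set star_algebra" where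
  "podles_patch Q S = presented patch_bar (patch_rels Q S)"


section \<open>The quantum group and its Casimir\<close>

datatype uq_gen = UXp | UXm | UK | UKinv

fun uq_bar :: "uq_gen \<Rightarrow> uq_gen" where
  "uq_bar UXp = UXm"
| "uq_bar UXm = UXp"
| "uq_bar UK = UK"
| "uq_bar UKinv = UKinv"

definition uq_rels :: "real \<Rightarrow> uq_gen free set" where
  "uq_rels q =
    {gen UK * gen UKinv - 1,
     gen UKinv * gen UK - 1,
     gen UK * gen UXp * gen UKinv - rscalar q * gen UXp,
     gen UK * gen UXm * gen UKinv - rscalar (1 / q) * gen UXm,
     gen UXp * gen UXm - gen UXm * gen UXp
       - rscalar (1 / (q - 1 / q)) * (gen UK ^ 2 - gen UKinv ^ 2)}"

definition uq_su2 :: "real \<Rightarrow> uq_gen free set star_algebra" where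
  "uq_su2 q = presented uq_bar (uq_rels q)"

definition casimir :: "real \<Rightarrow> uq_gen free" where
  "casimir q = rscalar (1 / q) * gen UK ^ 2 + rscalar q * gen UKinv ^ 2
     + rscalar ((q - 1 / q) ^ 2) * gen UXp * gen UXm"

definition uq_casimir_rels :: "real \<Rightarrow> real \<Rightarrow> uq_gen free set" where
  "uq_casimir_rels q \<tau> = insert (casimir q - rscalar \<tau>) (uq_rels q)"

definition uq_su2_casimir :: "real \<Rightarrow> real \<Rightarrow> uq_gen free set star_algebra" where
  "uq_su2_casimir q \<tau> = presented uq_bar (uq_casimir_rels q \<tau>)"

text \<open>Every relation of \<^const>\<open>uq_su2_casimir\<close> is even. The even part is generated by
  \<open>K\<^sup>2\<close>, \<open>K\<^sup>-\<^sup>2\<close>, \<open>x\<^sub>+ K\<^sup>-\<^sup>1\<close> and \<open>K\<^sup>-\<^sup>1 x\<^sub>-\<close>: it is the form of \<open>U\<^sub>q(su\<^sub>2)\<close> in which the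
  group-like generator is \<open>K\<^sup>2\<close>, and adjoining the square root \<open>K\<close> of \<open>K\<^sup>2\<close> gives back all of
  \<^const>\<open>uq_su2_casimir\<close>.

  The patch is not isomorphic to the larger algebra that contains \<open>K\<close>. For \<open>t = q\<close> the latter has the
  two characters \<open>K \<mapsto> \<plusminus>1, x\<^sub>\<plusminus> \<mapsto> 0\<close>, whereas a character of the patch kills
  \<open>z\<close> and \<open>z\<^sup>*\<close> and must then send \<open>x\<close> to 1.\<close>

definition uq_su2_casimir_even :: "real \<Rightarrow> real \<Rightarrow> uq_gen free set star_algebra" where
  "uq_su2_casimir_even q \<tau> = even_part uq_bar (uq_casimir_rels q \<tau>)"

end

theory Submission
  imports Defs
begin

text \<open>Put \<open>\<mu> = q - q\<^sup>-\<^sup>1\<close> and choose \<open>\<alpha>\<close> with \<open>\<alpha>\<^sup>2 = t\<^sup>2 q \<mu>\<^sup>2\<close>, real if \<open>q > 0\<close>. Since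
  \<open>(-t\<^sup>2 + x)(1 - x) = t x (t + t\<^sup>-\<^sup>1 - t x\<^sup>-\<^sup>1 - t\<^sup>-\<^sup>1 x)\<close>, the Casimir relation becomes the relation for
  \<open>z\<^sup>* z\<close> under \<open>x \<mapsto> t q\<^sup>-\<^sup>1 K\<^sup>2\<close>, \<open>z \<mapsto> \<alpha> K x\<^sub>-\<close>, \<open>z\<^sup>* \<mapsto> \<alpha> x\<^sub>+ K\<close>. The image of this
  homomorphism \<open>\<theta>\<close> contains all products of two generators. For injectivity, let \<open>A\<close> be the patch and
  adjoin to it a square root \<open>K\<close> of \<open>q t\<^sup>-\<^sup>1 x\<close>; on \<open>A \<oplus> A K\<close>, elements of \<open>U\<^sub>q(su\<^sub>2)\<close> act by right
  multiplication, as two by two matrices over \<open>A\<close>. This gives a homomorphism \<open>\<psi>\<close> for which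
  \<open>\<psi> (\<theta> p)\<close> is diagonal with upper left entry \<open>p\<close>, so \<open>\<theta>\<close> is injective. All computations
  take place in free algebras, modulo the *-ideals of relations.\<close>


section \<open>The free algebra\<close>

text \<open>Adding the points of the support one at a time splits any element into single terms, so
  additive statements need to be checked on those only.\<close>

lemma single_add_induct:
  fixes p :: "'a \<Rightarrow>\<^sub>0 'b::ab_group_add"
  assumes "P 0" and "\<And>w c. P (Poly_Mapping.single w c)" and "\<And>p q. P p \<Longrightarrow> P q \<Longrightarrow> P (p + q)"
  shows "P p"
proof (induction p rule: update_induct)
  case const
  show ?case by (rule assms)
next
  case (update f a b)
  have "Poly_Mapping.update a b f = f + Poly_Mapping.single a b"
    using update by (intro poly_mapping_eqI)
      (auto simp: lookup_add lookup_update lookup_single in_keys_iff)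
  then show ?case using assms update by metis
qed

lemma Word_Nil: "Word [] = 0"
  by (simp add: zero_word_def)

lemma scalar_0 [simp]: "scalar 0 = 0"
  and scalar_1 [simp]: "scalar 1 = 1"
  and scalar_add: "scalar (a + b) = scalar a + scalar b"
  and scalar_diff: "scalar (a - b) = scalar a - scalar b"
  and scalar_uminus: "scalar (- a) = - scalar a"
  and scalar_mult: "scalar (a * b) = scalar a * scalar b"
  by (simp_all add: scalar_def single_add single_diff single_uminus mult_single)

lemma single_Word_Cons:
  "Poly_Mapping.single (Word (g # w)) (c::complex) = gen g * Poly_Mapping.single (Word w) c"
  by (simp add: gen_def mult_single)

lemma scalar_central: "p * scalar c = scalar c * p"
  by (induction p rule: single_add_induct)
    (simp_all add: scalar_def mult_single distrib_left distrib_right mult.commute)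

lemma free_induct [case_names scalar gen add mult]:
  assumes "\<And>c. P (scalar c)" and "\<And>g. P (gen g)"
    and add: "\<And>p q. P p \<Longrightarrow> P q \<Longrightarrow> P (p + q)" and "\<And>p q. P p \<Longrightarrow> P q \<Longrightarrow> P (p * q)"
  shows "P (p :: 'g free)"
proof (induction p rule: single_add_induct)
  case 1
  show ?case using assms(1)[of 0] by simp
next
  case (2 w c)
  have "P (Poly_Mapping.single (Word l) c)" for l
  proof (induction l)
    case Nil
    show ?case using assms(1)[of c] by (simp add: scalar_def zero_word_def)
  next
    case (Cons g l)
    then show ?case by (simp only: single_Word_Cons assms)
  qed
  then show ?case by (cases w) simp
qed (rule add)

text \<open>Written as an operator, a coefficient can be pulled out of any product by
  \<open>sm_simps\<close>. The simplifier then brings noncommutative monomials to the form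
  coefficient times word, with the arithmetic left to the complex numbers.\<close>

definition sm :: "complex \<Rightarrow> 'g free \<Rightarrow> 'g free" where
  "sm c p = scalar c * p"

lemma sm_simps:
  "sm c p * r = sm c (p * r)" "p * sm c r = sm c (p * r)" "sm c (sm d p) = sm (c * d) p"
  "sm c (p + r) = sm c p + sm c r" "sm c (p - r) = sm c p - sm c r" "sm c (- p) = - sm c p"
  "sm 0 p = 0" "sm 1 p = p" "sm c 0 = 0" "sm (- c) p = - sm c p"
proof -
  show "p * sm c r = sm c (p * r)"
    by (simp add: sm_def scalar_central[of p] flip: mult.assoc)
qed (simp_all add: sm_def scalar_mult scalar_uminus mult.assoc distrib_left right_diff_distrib)

lemma sm_left_distrib: "sm (a + b) p = sm a p + sm b p"
  by (simp add: sm_def scalar_add distrib_right)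

lemma sm_left_diff_distrib: "sm (a - b) p = sm a p - sm b p"
  by (simp add: sm_def scalar_diff left_diff_distrib)

lemma scalar_eq_sm: "scalar c = sm c 1"
  by (simp add: sm_def)

section \<open>The universal property of the free algebra\<close>

locale central_scalars =
  fixes s :: "complex \<Rightarrow> 'r::ring_1"
  assumes s_1: "s 1 = 1" and s_add: "s (a + b) = s a + s b" and s_mult: "s (a * b) = s a * s b"
    and s_central: "r * s a = s a * r"
begin

fun word_val :: "('g \<Rightarrow> 'r) \<Rightarrow> 'g word \<Rightarrow> 'r" where
  "word_val h (Word w) = prod_list (map h w)"

text \<open>The target may be any ring with central scalars: the free algebra serves for
  \<open>\<theta>\<close>, two by two matrices over it for \<open>\<psi>\<close>.\<close>

definition lift :: "('g \<Rightarrow> 'r) \<Rightarrow> 'g free \<Rightarrow> 'r" where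
  "lift h p = (\<Sum>w\<in>Poly_Mapping.keys p. s (Poly_Mapping.lookup p w) * word_val h w)"

lemma s_0: "s 0 = 0"
  using s_add[of 0 0] by simp

lemma word_val_add: "word_val h (v + w) = word_val h v * word_val h w"
  by (cases v; cases w) simp

lemma lift_single: "lift h (Poly_Mapping.single w c) = s c * word_val h w"
  by (cases "c = 0") (simp_all add: lift_def s_0)

lemma lift_0: "lift h 0 = 0"
  by (simp add: lift_def)

lemma lift_add: "lift h (p + r) = lift h p + lift h r"
  unfolding lift_def by (rule setsum_keys_plus_distrib) (simp_all add: s_0 s_add distrib_right)

lemma lift_uminus: "lift h (- p) = - lift h p"
  using lift_add[of h p "- p"] by (simp add: lift_0 minus_unique)

lemma lift_diff: "lift h (p - r) = lift h p - lift h r"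
  using lift_add[of h p "- r"] by (simp add: lift_uminus)

text \<open>Words multiply by concatenation, so only the coefficient \<open>s d\<close> has to move
  past \<open>word_val h v\<close>; this is where \<open>s_central\<close> enters.\<close>

lemma lift_mult_single:
  "lift h (Poly_Mapping.single v c * Poly_Mapping.single w d) =
    lift h (Poly_Mapping.single v c) * lift h (Poly_Mapping.single w d)"
proof -
  have "word_val h v * (s d * word_val h w) = s d * (word_val h v * word_val h w)"
    unfolding mult.assoc[symmetric] s_central[of "word_val h v"] ..
  then show ?thesis
    unfolding mult_single lift_single s_mult word_val_add mult.assoc by simp
qed

lemma lift_mult: "lift h (p * r) = lift h p * lift h r"
proof (induction p rule: single_add_induct)
  case (2 v c)
  show ?case
    by (induction r rule: single_add_induct)
      (simp_all only: lift_mult_single lift_0 lift_add distrib_left mult_zero_right)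
qed (simp_all only: lift_0 lift_add distrib_right mult_zero_left)

lemma lift_gen: "lift h (gen g) = h g"
  by (simp add: gen_def lift_single s_1)

lemma lift_scalar: "lift h (scalar c) = s c"
  by (simp add: scalar_def lift_single flip: Word_Nil)

lemma lift_1: "lift h 1 = 1"
  using lift_scalar[of h 1] by (simp add: s_1)

lemmas lift_simps = lift_0 lift_add lift_uminus lift_diff lift_mult lift_gen lift_scalar lift_1

end

interpretation free_lift: central_scalars "scalar :: complex \<Rightarrow> 'g free"
  by unfold_locales (simp_all only: scalar_1 scalar_add scalar_mult, rule scalar_central)

lemma free_lift_sm: "free_lift.lift h (sm c p) = sm c (free_lift.lift h p)"
  by (simp add: sm_def free_lift.lift_simps)


section \<open>The involution\<close>

lemma adj_word_add: "adj_word bar (v + w) = adj_word bar w + adj_word bar v"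
  by (cases v; cases w) simp

lemma adj_single: "adj bar (Poly_Mapping.single w c) = Poly_Mapping.single (adj_word bar w) (cnj c)"
  by (cases "c = 0") (simp_all add: adj_def)

lemma adj_0 [simp]: "adj bar 0 = 0"
  by (simp add: adj_def)

lemma adj_add: "adj bar (p + r) = adj bar p + adj bar r"
  unfolding adj_def by (rule setsum_keys_plus_distrib) (simp_all add: single_add)

lemma adj_uminus: "adj bar (- p) = - adj bar p"
  using adj_add[of bar p "- p"] by (simp add: minus_unique)

lemma adj_diff: "adj bar (p - r) = adj bar p - adj bar r"
  using adj_add[of bar p "- r"] by (simp add: adj_uminus)

lemma adj_mult: "adj bar (p * r) = adj bar r * adj bar p"
proof (induction p rule: single_add_induct)
  case (2 v c)
  show ?case
    by (induction r rule: single_add_induct)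
      (simp_all add: mult_single adj_single adj_word_add adj_add distrib_left distrib_right mult.commute)
qed (simp_all add: adj_add distrib_left distrib_right)

lemma adj_gen: "adj bar (gen g) = gen (bar g)"
  by (simp add: gen_def adj_single)

lemma adj_scalar: "adj bar (scalar c) = scalar (cnj c)"
  by (simp add: scalar_def adj_single zero_word_def)

lemma adj_1: "adj bar 1 = 1"
  using adj_scalar[of bar 1] by simp

lemma adj_sm: "adj bar (sm c p) = sm (cnj c) (adj bar p)"
  unfolding sm_def adj_mult adj_scalar by (rule scalar_central)

lemmas adj_simps = adj_add adj_uminus adj_diff adj_mult adj_gen adj_scalar adj_1 adj_sm

lemma adj_adj:
  assumes "\<And>g. bar (bar g) = g"
  shows "adj bar (adj bar p) = p"
  by (induction p rule: free_induct) (simp_all add: adj_simps assms)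


section \<open>Congruence modulo the relations\<close>

lemma free_ring_simps [simp]:
  "carrier free_ring = UNIV" "mult free_ring = (*)" "one free_ring = 1" "zero free_ring = 0"
  "add free_ring = (+)"
  by (simp_all add: free_ring_def)

lemma ring_free_ring: "ring (free_ring :: 'g free ring)"
proof (rule ringI)
  show "abelian_group (free_ring :: 'g free ring)"
  proof (rule abelian_groupI)
    show "\<exists>y\<in>carrier free_ring. y \<oplus>\<^bsub>free_ring\<^esub> p = \<zero>\<^bsub>free_ring\<^esub>" for p :: "'g free"
      by (intro bexI[of _ "- p"]) simp_all
  qed (simp_all add: algebra_simps)
  show "Group.monoid (free_ring :: 'g free ring)"
    by (rule monoidI) (simp_all add: algebra_simps)
qed (simp_all add: algebra_simps)

interpretation free_ring: ring "free_ring :: 'g free ring"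
  by (rule ring_free_ring)

lemma ideal_star_ideal: "ideal (star_ideal bar R) free_ring"
  unfolding star_ideal_def by (rule free_ring.genideal_ideal) simp

lemma star_ideal_0: "0 \<in> star_ideal bar R"
  using additive_subgroup.zero_closed[OF ideal.axioms(1)[OF ideal_star_ideal[of bar R]]] by simp

lemma star_ideal_add: "p \<in> star_ideal bar R \<Longrightarrow> r \<in> star_ideal bar R \<Longrightarrow> p + r \<in> star_ideal bar R"
  using additive_subgroup.a_closed[OF ideal.axioms(1)[OF ideal_star_ideal[of bar R]]] by simp

lemma star_ideal_mult_left: "p \<in> star_ideal bar R \<Longrightarrow> a * p \<in> star_ideal bar R"
  using ideal.I_l_closed[OF ideal_star_ideal[of bar R]] by simp

lemma star_ideal_mult_right: "p \<in> star_ideal bar R \<Longrightarrow> p * a \<in> star_ideal bar R"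
  using ideal.I_r_closed[OF ideal_star_ideal[of bar R]] by simp

lemma star_ideal_uminus: "p \<in> star_ideal bar R \<Longrightarrow> - p \<in> star_ideal bar R"
  using star_ideal_mult_left[of p bar R "- 1"] by simp

lemma star_ideal_rel: "r \<in> R \<Longrightarrow> r \<in> star_ideal bar R"
  and star_ideal_adj_rel: "r \<in> R \<Longrightarrow> adj bar r \<in> star_ideal bar R"
  using free_ring.genideal_self[of "R \<union> adj bar ` R"] by (auto simp: star_ideal_def)

text \<open>The elements with property \<open>P\<close> form a two-sided ideal that contains the
  generators, and the generated ideal is the least one. The single rule \<open>mult\<close> covers
  both sides and negation, with \<open>1\<close> or \<open>- 1\<close> as a factor.\<close>

lemma star_ideal_induct [consumes 1, case_names rel adj_rel zero add mult]:
  assumes "p \<in> star_ideal bar R"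
    and rel: "\<And>r. r \<in> R \<Longrightarrow> P r" and adj_rel: "\<And>r. r \<in> R \<Longrightarrow> P (adj bar r)"
    and zero: "P 0" and add: "\<And>p r. P p \<Longrightarrow> P r \<Longrightarrow> P (p + r)"
    and mult: "\<And>p a b. P p \<Longrightarrow> P (a * p * b)"
  shows "P p"
proof -
  have neg: "\<ominus>\<^bsub>free_ring\<^esub> a = - a" for a :: "'a free"
    by (rule free_ring.minus_equality) simp_all
  \<comment> \<open>The subgroup condition in \<open>idealI\<close> speaks of this inverse, which
    has to be recognized as the minus of the ring.\<close>
  have inv: "inv\<^bsub>\<lparr>carrier = UNIV, mult = (+), one = 0\<rparr>\<^esub> a = - a" for a :: "'a free"
    using neg[of a] by (simp add: a_inv_def)
  have "P (- p)" if "P p" for p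
    using mult[OF that, of "- 1" 1] by simp
  moreover have "P (a * p)" "P (p * a)" if "P p" for p a
    using mult[OF that, of a 1] mult[OF that, of 1 a] by simp_all
  ultimately have "ideal {p. P p} free_ring"
    by (intro idealI subgroup.intro)
      (auto simp: zero add ring_free_ring inv)
  then have "star_ideal bar R \<subseteq> {p. P p}"
    unfolding star_ideal_def by (rule free_ring.genideal_minimal) (auto simp: rel adj_rel)
  then show ?thesis using assms(1) by auto
qed

text \<open>Equality in the presented algebra, expressed through representatives; by
  \<open>cls_eq_iff\<close>, calculations need no cosets.\<close>

definition pcong :: "('g \<Rightarrow> 'g) \<Rightarrow> 'g free set \<Rightarrow> 'g free \<Rightarrow> 'g free \<Rightarrow> bool" where
  "pcong bar R p r \<longleftrightarrow> p - r \<in> star_ideal bar R"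

lemma pcong_refl [simp]: "pcong bar R p p"
  by (simp add: pcong_def star_ideal_0)

lemma pcong_sym: "pcong bar R p r \<Longrightarrow> pcong bar R r p"
  unfolding pcong_def using star_ideal_uminus by fastforce

lemma pcong_trans [trans]: "pcong bar R a b \<Longrightarrow> pcong bar R b c \<Longrightarrow> pcong bar R a c"
  unfolding pcong_def using star_ideal_add[of "a - b" bar R "b - c"] by simp

lemma pcong_add: "pcong bar R a b \<Longrightarrow> pcong bar R c d \<Longrightarrow> pcong bar R (a + c) (b + d)"
  unfolding pcong_def using star_ideal_add[of "a - b" bar R "c - d"] by (simp add: algebra_simps)

lemma pcong_uminus: "pcong bar R a b \<Longrightarrow> pcong bar R (- a) (- b)"
  unfolding pcong_def using star_ideal_uminus[of "a - b" bar R] by (simp add: algebra_simps)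

lemma pcong_diff: "pcong bar R a b \<Longrightarrow> pcong bar R c d \<Longrightarrow> pcong bar R (a - c) (b - d)"
  using pcong_add[of bar R a b "- c" "- d"] pcong_uminus[of bar R c d] by simp

lemma pcong_mult:
  assumes "pcong bar R a b" and "pcong bar R c d"
  shows "pcong bar R (a * c) (b * d)"
proof -
  have "(a - b) * c + b * (c - d) \<in> star_ideal bar R"
    using assms by (auto simp: pcong_def intro: star_ideal_add star_ideal_mult_left star_ideal_mult_right)
  then show ?thesis by (simp add: pcong_def algebra_simps)
qed

lemma pcong_ctx: "pcong bar R p r \<Longrightarrow> pcong bar R (a * p * b) (a * r * b)"
  by (intro pcong_mult) simp_all

lemma pcong_sm: "pcong bar R p r \<Longrightarrow> pcong bar R (sm c p) (sm c r)"
  unfolding sm_def by (intro pcong_mult) simp_all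

lemma pcong_0_iff: "pcong bar R (a - b) 0 \<longleftrightarrow> pcong bar R a b"
  by (simp add: pcong_def)

lemma pcong_sm_mult: "pcong bar R p (sm d r) \<Longrightarrow> c * d = e \<Longrightarrow> pcong bar R (sm c p) (sm e r)"
  using pcong_sm[of bar R p "sm d r" c] by (simp add: sm_simps)

lemma pcong_rel: "a - b \<in> R \<Longrightarrow> pcong bar R a b"
  by (simp add: pcong_def star_ideal_rel)

lemma pcong_adj_rel: "a - b \<in> R \<Longrightarrow> pcong bar R (adj bar a) (adj bar b)"
  unfolding pcong_def using star_ideal_adj_rel[of "a - b" R bar] by (simp add: adj_diff)


section \<open>Presented algebras\<close>

lemma presented_simps:
  "carrier (presented bar R) = range (cls bar R)"
  "cls bar R a \<otimes>\<^bsub>presented bar R\<^esub> cls bar R b = cls bar R (a * b)"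
  "cls bar R a \<oplus>\<^bsub>presented bar R\<^esub> cls bar R b = cls bar R (a + b)"
  "\<one>\<^bsub>presented bar R\<^esub> = cls bar R 1"
  "\<zero>\<^bsub>presented bar R\<^esub> = cls bar R 0"
  "c \<odot>\<^bsub>presented bar R\<^esub> cls bar R a = cls bar R (scalar c * a)"
  "star (presented bar R) X = adj bar ` X"
proof -
  interpret ideal "star_ideal bar R" free_ring by (rule ideal_star_ideal)
  show "carrier (presented bar R) = range (cls bar R)"
    by (auto simp: presented_def Let_def FactRing_def A_RCOSETS_defs cls_def a_r_coset_def)
  show mult: "cls bar R a \<otimes>\<^bsub>presented bar R\<^esub> cls bar R b = cls bar R (a * b)" for a b
    using rcoset_mult_add[of a b] by (simp add: presented_def Let_def FactRing_def cls_def)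
  show "cls bar R a \<oplus>\<^bsub>presented bar R\<^esub> cls bar R b = cls bar R (a + b)"
    using a_rcos_sum[of a b] by (simp add: presented_def Let_def FactRing_def cls_def)
  show "\<one>\<^bsub>presented bar R\<^esub> = cls bar R 1"
    by (simp add: presented_def Let_def FactRing_def cls_def)
  show "\<zero>\<^bsub>presented bar R\<^esub> = cls bar R 0"
    using free_ring.a_coset_add_zero[of "star_ideal bar R"]
    by (simp add: presented_def Let_def FactRing_def cls_def)
  show "c \<odot>\<^bsub>presented bar R\<^esub> cls bar R a = cls bar R (scalar c * a)"
    using mult[of "scalar c" a] by (simp add: presented_def Let_def)
  show "star (presented bar R) X = adj bar ` X"
    by (simp add: presented_def Let_def)
qed

lemma mem_cls_iff: "r \<in> cls bar R p \<longleftrightarrow> pcong bar R r p"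
  by (auto simp: cls_def a_r_coset_def r_coset_def pcong_def intro: bexI[of _ "r - p"])

lemma cls_eq_iff: "cls bar R p = cls bar R r \<longleftrightarrow> pcong bar R p r"
  by (auto simp: set_eq_iff mem_cls_iff intro: pcong_trans pcong_sym)

lemma ring_presented: "ring (presented bar R)"
proof (rule ringI)
  show "abelian_group (presented bar R)"
  proof (rule abelian_groupI)
    fix X assume "X \<in> carrier (presented bar R)"
    then obtain p where "X = cls bar R p" by (auto simp: presented_simps)
    then show "\<exists>Y\<in>carrier (presented bar R). Y \<oplus>\<^bsub>presented bar R\<^esub> X = \<zero>\<^bsub>presented bar R\<^esub>"
      by (intro bexI[of _ "cls bar R (- p)"]) (simp_all add: presented_simps)
  qed (auto simp: presented_simps algebra_simps)
  show "Group.monoid (presented bar R)"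
    by (rule monoidI) (auto simp: presented_simps algebra_simps)
qed (auto simp: presented_simps algebra_simps)

text \<open>An involutive \<open>bar\<close> makes \<open>adj bar\<close> exchange the relations
  with their adjoints, so the ideal generated by both is mapped to itself.\<close>

lemma pcong_adj:
  assumes bar: "\<And>g. bar (bar g) = g" and "pcong bar R p r"
  shows "pcong bar R (adj bar p) (adj bar r)"
proof -
  have "adj bar a \<in> star_ideal bar R" if "a \<in> star_ideal bar R" for a
    using that
    by (induction rule: star_ideal_induct)
      (auto simp: star_ideal_0 star_ideal_adj_rel adj_adj[of bar, OF bar] star_ideal_rel adj_add adj_mult
        intro: star_ideal_add star_ideal_mult_left star_ideal_mult_right)
  from this[of "p - r"] show ?thesis using assms(2) by (simp add: pcong_def adj_diff)
qed

text \<open>The star of a class is defined as an image of sets. It fills the whole class of the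
  adjoint because \<open>adj bar\<close> is its own inverse.\<close>

lemma adj_image_cls:
  assumes bar: "\<And>g. bar (bar g) = g"
  shows "adj bar ` cls bar R p = cls bar R (adj bar p)"
proof (intro equalityI subsetI)
  fix r assume "r \<in> cls bar R (adj bar p)"
  then have "pcong bar R (adj bar r) (adj bar (adj bar p))"
    using pcong_adj[of bar, OF bar] by (simp add: mem_cls_iff)
  then have "adj bar r \<in> cls bar R p"
    by (simp add: mem_cls_iff adj_adj[of bar, OF bar])
  then show "r \<in> adj bar ` cls bar R p"
    by (metis adj_adj[of bar, OF bar] imageI)
qed (auto simp: mem_cls_iff intro: pcong_adj[of bar, OF bar])

section \<open>The even part and isomorphisms onto it\<close>

lemma even_part_simps:
  "carrier (even_part bar R) = generate_ring (presented bar R)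
     (range (\<lambda>c. cls bar R (scalar c)) \<union> {cls bar R (gen g * gen h) |g h. True})"
  "mult (even_part bar R) = mult (presented bar R)"
  "add (even_part bar R) = add (presented bar R)"
  "one (even_part bar R) = one (presented bar R)"
  "zero (even_part bar R) = zero (presented bar R)"
  "smult (even_part bar R) = smult (presented bar R)"
  "star (even_part bar R) = star (presented bar R)"
  by (simp_all add: even_part_def)

lemma even_part_scalar: "cls bar R (scalar c) \<in> carrier (even_part bar R)"
  and even_part_gens: "cls bar R (gen g * gen h) \<in> carrier (even_part bar R)"
  by (auto simp: even_part_simps intro!: generate_ring.incl)

lemma even_part_add:
  "cls bar R a \<in> carrier (even_part bar R) \<Longrightarrow> cls bar R b \<in> carrier (even_part bar R) \<Longrightarrow>
    cls bar R (a + b) \<in> carrier (even_part bar R)"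
  and even_part_mult:
  "cls bar R a \<in> carrier (even_part bar R) \<Longrightarrow> cls bar R b \<in> carrier (even_part bar R) \<Longrightarrow>
    cls bar R (a * b) \<in> carrier (even_part bar R)"
  using generate_ring.eng_add[of "cls bar R a" "presented bar R" _ "cls bar R b"]
    generate_ring.eng_mult[of "cls bar R a" "presented bar R" _ "cls bar R b"]
  by (simp_all add: even_part_simps presented_simps)

text \<open>Scalars are among the generators, so negation is a product with -1 and gets no case of
  its own.\<close>

lemma even_part_induct:
  assumes "X \<in> carrier (even_part bar R)"
    and scalar: "\<And>c. P (cls bar R (scalar c))" and gens: "\<And>g h. P (cls bar R (gen g * gen h))"
    and add: "\<And>a b. P (cls bar R a) \<Longrightarrow> P (cls bar R b) \<Longrightarrow> P (cls bar R (a + b))"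
    and mult: "\<And>a b. P (cls bar R a) \<Longrightarrow> P (cls bar R b) \<Longrightarrow> P (cls bar R (a * b))"
  shows "P X"
proof -
  interpret ring "presented bar R" by (rule ring_presented)
  have "X \<in> range (cls bar R) \<and> P X"
    using assms(1) unfolding even_part_simps
  proof (induction rule: generate_ring.induct)
    case one
    show ?case using scalar[of 1] by (simp add: presented_simps)
  next
    case (incl X)
    then show ?case using scalar gens by auto
  next
    case (a_inv X)
    then obtain p where p: "X = cls bar R p" "P (cls bar R p)" by auto
    have "\<ominus>\<^bsub>presented bar R\<^esub> X = cls bar R (scalar (- 1) * p)"
      by (rule minus_equality) (auto simp: presented_simps p scalar_uminus)
    then show ?case using mult[OF scalar p(2)] by auto
  next
    case (eng_add X Y)
    then obtain p r where "X = cls bar R p" "Y = cls bar R r" by auto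
    then show ?case using add[of p r] eng_add.IH by (simp add: presented_simps)
  next
    case (eng_mult X Y)
    then obtain p r where "X = cls bar R p" "Y = cls bar R r" by auto
    then show ?case using mult[of p r] eng_mult.IH by (simp add: presented_simps)
  qed
  then show ?thesis ..
qed

text \<open>\<open>cong\<close> makes the map on classes well defined and \<open>inj\<close> makes
  it injective. By \<open>even\<close> the image lies in the even part, and by \<open>surj\<close>
  it contains the products that generate this part over the scalars.\<close>

lemma induced_iso:
  fixes \<theta> :: "'g free \<Rightarrow> 'h free"
  assumes hom: "\<And>p r. \<theta> (p + r) = \<theta> p + \<theta> r" "\<And>p r. \<theta> (p * r) = \<theta> p * \<theta> r"
      "\<And>c. \<theta> (scalar c) = scalar c"
    and cong: "\<And>p r. pcong bar R p r \<Longrightarrow> pcong bar' R' (\<theta> p) (\<theta> r)"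
    and inj: "\<And>p r. pcong bar' R' (\<theta> p) (\<theta> r) \<Longrightarrow> pcong bar R p r"
    and even: "\<And>g. cls bar' R' (\<theta> (gen g)) \<in> carrier (even_part bar' R')"
    and surj: "\<And>g h. \<exists>p. pcong bar' R' (gen g * gen h) (\<theta> p)"
  obtains f where "f \<in> alg_iso (presented bar R) (even_part bar' R')"
    and "\<And>p. f (cls bar R p) = cls bar' R' (\<theta> p)"
proof
  \<comment> \<open>An arbitrary representative is chosen; \<open>cong\<close> shows that the choice
    does not matter.\<close>
  define f where "f X = cls bar' R' (\<theta> (SOME p. X = cls bar R p))" for X
  show f: "f (cls bar R p) = cls bar' R' (\<theta> p)" for p
  proof -
    have "cls bar R p = cls bar R (SOME r. cls bar R p = cls bar R r)"
      by (rule someI) simp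
    then show ?thesis
      unfolding f_def cls_eq_iff by (intro cong) (metis pcong_sym)
  qed
  have in_even: "cls bar' R' (\<theta> p) \<in> carrier (even_part bar' R')" for p
    by (induction p rule: free_induct)
      (simp_all add: hom even even_part_scalar even_part_add even_part_mult)
  have "\<exists>p. X = cls bar' R' (\<theta> p)" if "X \<in> carrier (even_part bar' R')" for X
    using that
  proof (rule even_part_induct)
    show "\<exists>p. cls bar' R' (scalar c) = cls bar' R' (\<theta> p)" for c by (metis hom(3))
    show "\<exists>p. cls bar' R' (gen g * gen h) = cls bar' R' (\<theta> p)" for g h
      using surj by (simp add: cls_eq_iff)
    show "\<exists>p. cls bar' R' (a + b) = cls bar' R' (\<theta> p)"
      if "\<exists>p. cls bar' R' a = cls bar' R' (\<theta> p)" "\<exists>p. cls bar' R' b = cls bar' R' (\<theta> p)" for a b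
      using that unfolding cls_eq_iff by (metis hom(1) pcong_add)
    show "\<exists>p. cls bar' R' (a * b) = cls bar' R' (\<theta> p)"
      if "\<exists>p. cls bar' R' a = cls bar' R' (\<theta> p)" "\<exists>p. cls bar' R' b = cls bar' R' (\<theta> p)" for a b
      using that unfolding cls_eq_iff by (metis hom(2) pcong_mult)
  qed
  then have "carrier (even_part bar' R') = range (\<lambda>p. cls bar' R' (\<theta> p))"
    using in_even by blast
  then have "f ` carrier (presented bar R) = carrier (even_part bar' R')"
    by (simp add: presented_simps image_image f)
  moreover have "inj_on f (carrier (presented bar R))"
    by (auto simp: inj_on_def presented_simps f cls_eq_iff intro: inj)
  ultimately have "bij_betw f (carrier (presented bar R)) (carrier (even_part bar' R'))"
    by (simp add: bij_betw_def)
  then show "f \<in> alg_iso (presented bar R) (even_part bar' R')"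
    using hom(3)[of 1]
    by (auto simp: alg_iso_def ring_iso_def presented_simps even_part_simps(2-) f hom in_even
        intro!: ring_hom_memI)
qed

lemma alg_iso_imp_star_alg_iso:
  assumes f: "f \<in> alg_iso (presented bar R) (even_part bar' R')"
    and f_cls: "\<And>p. f (cls bar R p) = cls bar' R' (\<theta> p)"
    and bar: "\<And>g. bar (bar g) = g" and bar': "\<And>g. bar' (bar' g) = g"
    and adj: "\<And>p. \<theta> (adj bar p) = adj bar' (\<theta> p)"
  shows "f \<in> star_alg_iso (presented bar R) (even_part bar' R')"
  using f by (auto simp: star_alg_iso_def presented_simps even_part_simps(7) f_cls adj
      adj_image_cls[of bar, OF bar] adj_image_cls[of bar', OF bar'])


section \<open>Two by two matrices\<close>

datatype 'a mat2 = Mat2 'a 'a 'a 'a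

instantiation mat2 :: (ring_1) ring_1
begin

definition "0 = Mat2 0 0 0 0"
definition "1 = Mat2 1 0 0 1"
fun plus_mat2 :: "'a mat2 \<Rightarrow> 'a mat2 \<Rightarrow> 'a mat2" where
  "plus_mat2 (Mat2 a b c d) (Mat2 a' b' c' d') = Mat2 (a + a') (b + b') (c + c') (d + d')"
fun minus_mat2 :: "'a mat2 \<Rightarrow> 'a mat2 \<Rightarrow> 'a mat2" where
  "minus_mat2 (Mat2 a b c d) (Mat2 a' b' c' d') = Mat2 (a - a') (b - b') (c - c') (d - d')"
fun uminus_mat2 :: "'a mat2 \<Rightarrow> 'a mat2" where
  "uminus_mat2 (Mat2 a b c d) = Mat2 (- a) (- b) (- c) (- d)"
fun times_mat2 :: "'a mat2 \<Rightarrow> 'a mat2 \<Rightarrow> 'a mat2" where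
  "times_mat2 (Mat2 a b c d) (Mat2 a' b' c' d') =
    Mat2 (a * a' + b * c') (a * b' + b * d') (c * a' + d * c') (c * b' + d * d')"

instance
proof
  fix m n k :: "'a mat2"
  show "m * n * k = m * (n * k)" by (cases m; cases n; cases k) (simp add: algebra_simps)
  show "1 * m = m" "m * 1 = m" by (cases m; simp add: one_mat2_def)+
  show "m + n + k = m + (n + k)" by (cases m; cases n; cases k) (simp add: algebra_simps)
  show "m + n = n + m" by (cases m; cases n) (simp add: algebra_simps)
  show "0 + m = m" "- m + m = 0" by (cases m; simp add: zero_mat2_def)+
  show "m - n = m + - n" by (cases m; cases n) simp
  show "(m + n) * k = m * k + n * k" "m * (n + k) = m * n + m * k"
    by (cases m; cases n; cases k; simp add: algebra_simps)+
  show "(0 :: 'a mat2) \<noteq> 1" by (simp add: zero_mat2_def one_mat2_def)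
qed

end

definition diag_scalar :: "complex \<Rightarrow> 'g free mat2" where
  "diag_scalar c = Mat2 (scalar c) 0 0 (scalar c)"

interpretation mat2_lift: central_scalars "diag_scalar :: complex \<Rightarrow> 'g free mat2"
proof
  fix m :: "'g free mat2" and a
  show "m * diag_scalar a = diag_scalar a * m"
    by (cases m) (simp add: diag_scalar_def scalar_central[of _ a])
qed (simp_all add: diag_scalar_def scalar_add scalar_mult one_mat2_def)

text \<open>The entries stay in the free algebra; this is equality of matrices over the presented
  algebra.\<close>

fun mat2_cong :: "('g \<Rightarrow> 'g) \<Rightarrow> 'g free set \<Rightarrow> 'g free mat2 \<Rightarrow> 'g free mat2 \<Rightarrow> bool" where
  "mat2_cong bar R (Mat2 a b c d) (Mat2 a' b' c' d') \<longleftrightarrow>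
    pcong bar R a a' \<and> pcong bar R b b' \<and> pcong bar R c c' \<and> pcong bar R d d'"

lemma mat2_cong_refl: "mat2_cong bar R m m"
  by (cases m) simp

lemma mat2_cong_add:
  "mat2_cong bar R m n \<Longrightarrow> mat2_cong bar R m' n' \<Longrightarrow> mat2_cong bar R (m + m') (n + n')"
  by (cases m; cases n; cases m'; cases n') (simp add: pcong_add)

lemma mat2_cong_diff:
  "mat2_cong bar R m n \<Longrightarrow> mat2_cong bar R m' n' \<Longrightarrow> mat2_cong bar R (m - m') (n - n')"
  by (cases m; cases n; cases m'; cases n') (simp add: pcong_diff)

lemma mat2_cong_mult:
  "mat2_cong bar R m n \<Longrightarrow> mat2_cong bar R m' n' \<Longrightarrow> mat2_cong bar R (m * m') (n * n')"
  by (cases m; cases n; cases m'; cases n') (simp add: pcong_add pcong_mult)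

lemma mat2_cong_0_iff: "mat2_cong bar R (m - n) 0 \<longleftrightarrow> mat2_cong bar R m n"
  by (cases m; cases n) (simp add: zero_mat2_def pcong_0_iff)


section \<open>The homomorphism from the patch\<close>

text \<open>The number \<open>\<alpha>\<close> is complex since its square has the sign of
  \<open>q\<close>; both signs are thus treated together.\<close>

locale podles_uq =
  fixes q t :: real and \<alpha> :: complex
  assumes q_0: "q \<noteq> 0" and q_q: "q - 1 / q \<noteq> 0" and t_0: "t \<noteq> 0"
    and \<alpha>_sq: "\<alpha>\<^sup>2 = complex_of_real (t\<^sup>2 * q * (q - 1 / q)\<^sup>2)"
begin

abbreviation cq :: complex where "cq \<equiv> complex_of_real q"
abbreviation ct :: complex where "ct \<equiv> complex_of_real t"

declare q_0 [simp] t_0 [simp]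

lemma cq_diff [simp]: "cq - 1 / cq \<noteq> 0"
  using q_q by (metis of_real_1 of_real_diff of_real_divide of_real_eq_0_iff)

lemma \<alpha>_\<alpha>: "\<alpha> * \<alpha> = ct\<^sup>2 * cq * (cq - 1 / cq)\<^sup>2"
  using \<alpha>_sq by (simp add: power2_eq_square)

lemma \<alpha>_0 [simp]: "\<alpha> \<noteq> 0"
  using \<alpha>_\<alpha> cq_diff by (auto simp del: cq_diff)

text \<open>\<open>Y\<close> and \<open>L\<close> are the inverses of \<open>X\<close> and \<open>K\<close>; \<open>E\<close> and \<open>F\<close> are the paper's
  \<open>x\<^sub>+\<close> and \<open>x\<^sub>-\<close>.\<close>

abbreviation X where "X \<equiv> gen TX"
abbreviation Y where "Y \<equiv> gen TXinv"
abbreviation Z where "Z \<equiv> gen TZ"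
abbreviation Z' where "Z' \<equiv> gen TZstar"
abbreviation K where "K \<equiv> gen UK"
abbreviation L where "L \<equiv> gen UKinv"
abbreviation E where "E \<equiv> gen UXp"
abbreviation F where "F \<equiv> gen UXm"

abbreviation cong_patch (infix "\<approx>" 50) where
  "p \<approx> r \<equiv> pcong patch_bar (patch_rels (q\<^sup>2) (- t\<^sup>2)) p r"

abbreviation cong_uq (infix "\<simeq>\<^sub>U" 50) where
  "p \<simeq>\<^sub>U r \<equiv> pcong uq_bar (uq_casimir_rels q (t + 1 / t)) p r"

lemmas cnorm = scalar_eq_sm sm_simps mult.assoc

section \<open>Commutation rules in the patch\<close>

lemma XY: "X * Y \<approx> 1" and YX: "Y * X \<approx> 1"
  by (rule pcong_rel; simp add: patch_rels_def)+

lemma ZX: "Z * X \<approx> sm (cq\<^sup>2) (X * Z)"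
proof -
  have "Z * X \<approx> rscalar (q\<^sup>2) * X * Z"
    by (rule pcong_rel) (simp add: patch_rels_def podles_rels_def)
  then show ?thesis by (simp add: cnorm)
qed

text \<open>This is the adjoint of the relation for \<open>Z * X\<close>, available because the
  ideal is generated by the relations together with their adjoints.\<close>

lemma XZ': "X * Z' \<approx> sm (cq\<^sup>2) (Z' * X)"
proof -
  have "adj patch_bar (Z * X) \<approx> adj patch_bar (rscalar (q\<^sup>2) * X * Z)"
    by (rule pcong_adj_rel) (simp add: patch_rels_def podles_rels_def)
  then show ?thesis by (simp add: adj_simps cnorm)
qed

lemma ZZ': "Z * Z' \<approx> sm (- ct\<^sup>2) 1 + sm (cq\<^sup>2 * (1 + ct\<^sup>2)) X - sm (cq ^ 4) (X * X)"
proof -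
  have "Z * Z' \<approx> (rscalar (- t\<^sup>2) + rscalar (q\<^sup>2) * X) * (1 - rscalar (q\<^sup>2) * X)"
    by (rule pcong_rel) (simp add: patch_rels_def podles_rels_def)
  also have "(rscalar (- t\<^sup>2) + rscalar (q\<^sup>2) * X) * (1 - rscalar (q\<^sup>2) * X) =
      sm (- ct\<^sup>2) 1 + sm (cq\<^sup>2 * (1 + ct\<^sup>2)) X - sm (cq ^ 4) (X * X)"
    by (simp add: cnorm distrib_left distrib_right left_diff_distrib right_diff_distrib
        sm_left_distrib power2_eq_square power4_eq_xxxx)
  finally show ?thesis .
qed

lemma Z'Z: "Z' * Z \<approx> sm (- ct\<^sup>2) 1 + sm (1 + ct\<^sup>2) X - X * X"
proof -
  have "Z' * Z \<approx> (rscalar (- t\<^sup>2) + X) * (1 - X)"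
    by (rule pcong_rel) (simp add: patch_rels_def podles_rels_def)
  also have "(rscalar (- t\<^sup>2) + X) * (1 - X) = sm (- ct\<^sup>2) 1 + sm (1 + ct\<^sup>2) X - X * X"
    by (simp add: cnorm distrib_left distrib_right left_diff_distrib right_diff_distrib
        sm_left_distrib)
  finally show ?thesis .
qed

text \<open>A factor \<open>X * Y\<close> is inserted on the right, \<open>ZX\<close> moves its
  \<open>X\<close> to the left of \<open>Z\<close>, and \<open>Y * X\<close> cancels there.\<close>

lemma YZ: "Y * Z \<approx> sm (cq\<^sup>2) (Z * Y)"
proof -
  have "Y * Z \<approx> Y * Z * X * Y"
    using pcong_ctx[OF pcong_sym[OF XY], of "Y * Z" 1] by (simp add: cnorm)
  also have "\<dots> \<approx> sm (cq\<^sup>2) (Y * X * Z * Y)"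
    using pcong_ctx[OF ZX, of Y Y] by (simp add: cnorm)
  also have "\<dots> \<approx> sm (cq\<^sup>2) (Z * Y)"
    using pcong_sm[OF pcong_ctx[OF YX, of 1 "Z * Y"]] by (simp add: cnorm)
  finally show ?thesis .
qed

lemma Z'Y: "Z' * Y \<approx> sm (cq\<^sup>2) (Y * Z')"
proof -
  have "Z' * Y \<approx> Y * X * Z' * Y"
    using pcong_ctx[OF pcong_sym[OF YX], of 1 "Z' * Y"] by (simp add: cnorm)
  also have "\<dots> \<approx> sm (cq\<^sup>2) (Y * Z' * X * Y)"
    using pcong_ctx[OF XZ', of Y Y] by (simp add: cnorm)
  also have "\<dots> \<approx> sm (cq\<^sup>2) (Y * Z')"
    using pcong_sm[OF pcong_ctx[OF XY, of "Y * Z'" 1]] by (simp add: cnorm)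
  finally show ?thesis .
qed

section \<open>Commutation rules in U_q(su_2) modulo the Casimir relation\<close>

lemma KL: "K * L \<simeq>\<^sub>U 1" and LK: "L * K \<simeq>\<^sub>U 1"
  by (rule pcong_rel; simp add: uq_casimir_rels_def uq_rels_def)+

lemma KE: "K * E \<simeq>\<^sub>U sm cq (E * K)"
proof -
  have rel: "K * E * L \<simeq>\<^sub>U rscalar q * E"
    by (rule pcong_rel) (simp add: uq_casimir_rels_def uq_rels_def)
  have "K * E \<simeq>\<^sub>U K * E * L * K"
    using pcong_ctx[OF pcong_sym[OF LK], of "K * E" 1] by (simp add: cnorm)
  also have "\<dots> \<simeq>\<^sub>U sm cq (E * K)"
    using pcong_ctx[OF rel, of 1 K] by (simp add: cnorm)
  finally show ?thesis .
qed

lemma KF: "K * F \<simeq>\<^sub>U sm (1 / cq) (F * K)"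
proof -
  have rel: "K * F * L \<simeq>\<^sub>U rscalar (1 / q) * F"
    by (rule pcong_rel) (simp add: uq_casimir_rels_def uq_rels_def)
  have "K * F \<simeq>\<^sub>U K * F * L * K"
    using pcong_ctx[OF pcong_sym[OF LK], of "K * F" 1] by (simp add: cnorm)
  also have "\<dots> \<simeq>\<^sub>U sm (1 / cq) (F * K)"
    using pcong_ctx[OF rel, of 1 K] by (simp add: cnorm)
  finally show ?thesis .
qed

text \<open>The Casimir relation solved for \<open>E * F\<close>; the factor in front is the one
  that occurs in \<open>\<alpha>_\<alpha>\<close>.\<close>

lemma EF: "sm ((cq - 1 / cq)\<^sup>2) (E * F) \<simeq>\<^sub>U
    sm (ct + 1 / ct) 1 - sm (1 / cq) (K * K) - sm cq (L * L)"
proof -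
  have "casimir q \<simeq>\<^sub>U rscalar (t + 1 / t)"
    by (rule pcong_rel) (simp add: uq_casimir_rels_def)
  moreover have "casimir q = sm (1 / cq) (K * K) + sm cq (L * L) + sm ((cq - 1 / cq)\<^sup>2) (E * F)"
    by (simp add: casimir_def cnorm power2_eq_square[of K] power2_eq_square[of L])
  ultimately have "sm (1 / cq) (K * K) + sm cq (L * L) + sm ((cq - 1 / cq)\<^sup>2) (E * F) \<simeq>\<^sub>U
      sm (ct + 1 / ct) 1"
    by (simp add: scalar_eq_sm)
  from pcong_diff[OF this pcong_refl[of _ _ "sm (1 / cq) (K * K) + sm cq (L * L)"]]
  show ?thesis by (simp add: diff_diff_eq)
qed

lemma EF_FE: "E * F - F * E \<simeq>\<^sub>U sm (1 / (cq - 1 / cq)) (K * K - L * L)"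
proof -
  have "E * F - F * E \<simeq>\<^sub>U rscalar (1 / (q - 1 / q)) * (K ^ 2 - L ^ 2)"
    by (rule pcong_rel) (simp add: uq_casimir_rels_def uq_rels_def)
  then show ?thesis by (simp add: cnorm power2_eq_square)
qed

text \<open>The commutator relation is subtracted from \<open>EF\<close>. Its coefficient becomes q
  - 1/q, which interchanges the coefficients q and 1/q of K^2 and K^-2.\<close>

lemma FE: "sm ((cq - 1 / cq)\<^sup>2) (F * E) \<simeq>\<^sub>U
    sm (ct + 1 / ct) 1 - sm cq (K * K) - sm (1 / cq) (L * L)"
proof -
  have "sm ((cq - 1 / cq)\<^sup>2) (F * E) = sm ((cq - 1 / cq)\<^sup>2) (E * F) - sm ((cq - 1 / cq)\<^sup>2) (E * F - F * E)"
    by (simp add: cnorm)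
  also have "\<dots> \<simeq>\<^sub>U sm (ct + 1 / ct) 1 - sm (1 / cq) (K * K) - sm cq (L * L)
      - sm (cq - 1 / cq) (K * K - L * L)"
    by (intro pcong_diff[OF EF] pcong_sm_mult[OF EF_FE]) (simp add: power2_eq_square)
  also have "\<dots> = sm (ct + 1 / ct) 1 - sm cq (K * K) - sm (1 / cq) (L * L)"
    by (simp add: cnorm sm_left_distrib sm_left_diff_distrib)
  finally show ?thesis .
qed

text \<open>The factors in \<open>K * F\<close> and \<open>E * K\<close> are ordered so that the
  involution exchanges the two products; for real \<alpha> the images of \<open>TZ\<close> and
  \<open>TZstar\<close> are then adjoint to each other.\<close>

fun \<theta>_gen :: "patch_gen \<Rightarrow> uq_gen free" where
  "\<theta>_gen TX = sm (ct / cq) (K * K)"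
| "\<theta>_gen TXinv = sm (cq / ct) (L * L)"
| "\<theta>_gen TZ = sm \<alpha> (K * F)"
| "\<theta>_gen TZstar = sm \<alpha> (E * K)"

definition "\<theta> = free_lift.lift \<theta>_gen"

lemma \<theta>_simps:
  "\<theta> 0 = 0" "\<theta> 1 = 1" "\<theta> (p + r) = \<theta> p + \<theta> r" "\<theta> (p - r) = \<theta> p - \<theta> r" "\<theta> (p * r) = \<theta> p * \<theta> r"
  "\<theta> (scalar c) = scalar c" "\<theta> (sm c p) = sm c (\<theta> p)" "\<theta> (gen g) = \<theta>_gen g"
  by (simp_all add: \<theta>_def free_lift.lift_simps free_lift_sm)

section \<open>The relations of the patch under \<open>\<theta>\<close>\<close>

lemma KKE: "K * K * E \<simeq>\<^sub>U sm (cq\<^sup>2) (E * K * K)"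
proof -
  have "K * K * E \<simeq>\<^sub>U sm cq (K * E * K)"
    using pcong_ctx[OF KE, of K 1] by (simp add: cnorm)
  also have "\<dots> \<simeq>\<^sub>U sm (cq\<^sup>2) (E * K * K)"
    using pcong_sm_mult[of _ _ "K * E * K" cq "E * K * K" cq "cq\<^sup>2"] pcong_ctx[OF KE, of 1 K]
    by (simp add: cnorm power2_eq_square)
  finally show ?thesis .
qed

lemma FKK: "F * K * K \<simeq>\<^sub>U sm (cq\<^sup>2) (K * K * F)"
proof -
  have FK: "F * K \<simeq>\<^sub>U sm cq (K * F)"
    using pcong_sym[OF pcong_sm_mult[OF KF, of cq 1]] by (simp add: sm_simps(8))
  have "F * K * K \<simeq>\<^sub>U sm cq (K * F * K)"
    using pcong_ctx[OF FK, of 1 K] by (simp add: cnorm)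
  also have "\<dots> \<simeq>\<^sub>U sm (cq\<^sup>2) (K * K * F)"
    using pcong_sm_mult[of _ _ "K * F * K" cq "K * K * F" cq "cq\<^sup>2"] pcong_ctx[OF FK, of K 1]
    by (simp add: cnorm power2_eq_square)
  finally show ?thesis .
qed

lemma KKLL: "K * K * L * L \<simeq>\<^sub>U 1" and LLKK: "L * L * K * K \<simeq>\<^sub>U 1"
proof -
  have "K * K * L * L \<simeq>\<^sub>U K * L"
    using pcong_ctx[OF KL, of K L] by (simp add: cnorm)
  then show "K * K * L * L \<simeq>\<^sub>U 1" using KL by (rule pcong_trans)
  have "L * L * K * K \<simeq>\<^sub>U L * K"
    using pcong_ctx[OF LK, of L K] by (simp add: cnorm)
  then show "L * L * K * K \<simeq>\<^sub>U 1" using LK by (rule pcong_trans)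
qed

lemma \<theta>_ZX: "\<theta> (Z * X) \<simeq>\<^sub>U \<theta> (rscalar (q\<^sup>2) * X * Z)"
  using pcong_sm[OF pcong_ctx[OF FKK, of K 1], of "\<alpha> * (ct / cq)"]
  by (simp add: \<theta>_simps cnorm mult_ac)

text \<open>The adjoint of the preceding relation, with the right side in the form in which
  \<open>adj\<close> produces it.\<close>

lemma \<theta>_XZ': "\<theta> (X * Z') \<simeq>\<^sub>U \<theta> (Z' * (X * rscalar (q\<^sup>2)))"
  using pcong_sm[OF pcong_ctx[OF KKE, of 1 K], of "\<alpha> * (ct / cq)"]
  by (simp add: \<theta>_simps cnorm mult_ac)

text \<open>The image is \<alpha>^2 times \<open>K * F * E * K\<close>, and \<alpha>^2 supplies the
  factor (q - 1/q)^2 that \<open>FE\<close> asks for. The term with \<open>L * L\<close> collapses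
  to the constant -t^2.\<close>

lemma \<theta>_ZZ': "\<theta> (Z * Z') \<simeq>\<^sub>U
  \<theta> ((rscalar (- t\<^sup>2) + rscalar (q\<^sup>2) * X) * (1 - rscalar (q\<^sup>2) * X))"
proof -
  have "K * L * L * K \<simeq>\<^sub>U 1"
    using pcong_trans[OF pcong_ctx[OF KL, of 1 "L * K"]] LK by (simp add: cnorm)
  then have KLLK: "sm (ct\<^sup>2) (K * L * L * K) \<simeq>\<^sub>U sm (ct\<^sup>2) 1"
    by (rule pcong_sm)
  have "\<theta> (Z * Z') = sm (ct\<^sup>2 * cq) (K * sm ((cq - 1 / cq)\<^sup>2) (F * E) * K)"
    by (simp add: \<theta>_simps cnorm \<alpha>_\<alpha>)
  also have "\<dots> \<simeq>\<^sub>U sm (ct\<^sup>2 * cq) (K * (sm (ct + 1 / ct) 1 - sm cq (K * K) - sm (1 / cq) (L * L)) * K)"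
    by (intro pcong_sm pcong_ctx FE)
  also have "\<dots> = sm (ct\<^sup>2 * cq * (ct + 1 / ct)) (K * K) - sm (ct\<^sup>2 * cq * cq) (K * K * K * K)
      - sm (ct\<^sup>2) (K * L * L * K)"
    by (simp add: cnorm left_diff_distrib right_diff_distrib)
  also have "\<dots> \<simeq>\<^sub>U sm (ct\<^sup>2 * cq * (ct + 1 / ct)) (K * K) - sm (ct\<^sup>2 * cq * cq) (K * K * K * K)
      - sm (ct\<^sup>2) 1"
    by (intro pcong_diff pcong_refl KLLK)
  \<comment> \<open>Since \<open>X\<close> goes to t/q times K^2, this is the coefficient q^2 (1 +
    t^2) of \<open>X\<close> in the relation.\<close>
  also have "ct\<^sup>2 * cq * (ct + 1 / ct) = cq * ct + cq * ct * ct\<^sup>2"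
    by (simp add: field_simps power2_eq_square)
  also have "sm (cq * ct + cq * ct * ct\<^sup>2) (K * K) - sm (ct\<^sup>2 * cq * cq) (K * K * K * K) - sm (ct\<^sup>2) 1 =
      \<theta> ((rscalar (- t\<^sup>2) + rscalar (q\<^sup>2) * X) * (1 - rscalar (q\<^sup>2) * X))"
    by (simp add: \<theta>_simps cnorm distrib_left distrib_right left_diff_distrib right_diff_distrib
        sm_left_distrib power2_eq_square mult_ac)
  finally show ?thesis .
qed

lemma \<theta>_Z'Z: "\<theta> (Z' * Z) \<simeq>\<^sub>U \<theta> ((rscalar (- t\<^sup>2) + X) * (1 - X))"
proof -
  \<comment> \<open>The coefficient is divided and multiplied by q^2 so that \<open>KKE\<close>,
    read backwards, applies and brings \<open>E\<close> next to \<open>F\<close>.\<close>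
  have "\<theta> (Z' * Z) = sm (\<alpha> * \<alpha> / cq\<^sup>2) (sm (cq\<^sup>2) (E * K * K) * F)"
    by (simp add: \<theta>_simps cnorm)
  also have "\<dots> \<simeq>\<^sub>U sm (\<alpha> * \<alpha> / cq\<^sup>2) (K * K * E * F)"
    by (intro pcong_sm pcong_mult pcong_refl pcong_sym[OF KKE])
  also have "\<dots> = sm (ct\<^sup>2 / cq) (K * K * sm ((cq - 1 / cq)\<^sup>2) (E * F))"
    by (simp add: cnorm \<alpha>_\<alpha> power2_eq_square)
  also have "\<dots> \<simeq>\<^sub>U sm (ct\<^sup>2 / cq) (K * K * (sm (ct + 1 / ct) 1 - sm (1 / cq) (K * K) - sm cq (L * L)))"
    by (intro pcong_sm pcong_mult pcong_refl EF)
  also have "\<dots> = sm (ct\<^sup>2 / cq * (ct + 1 / ct)) (K * K) - sm (ct\<^sup>2 / cq\<^sup>2) (K * K * K * K)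
      - sm (ct\<^sup>2) (K * K * L * L)"
    by (simp add: cnorm left_diff_distrib right_diff_distrib power2_eq_square)
  also have "\<dots> \<simeq>\<^sub>U sm (ct\<^sup>2 / cq * (ct + 1 / ct)) (K * K) - sm (ct\<^sup>2 / cq\<^sup>2) (K * K * K * K)
      - sm (ct\<^sup>2) 1"
    by (intro pcong_diff pcong_refl pcong_sm KKLL)
  also have "ct\<^sup>2 / cq * (ct + 1 / ct) = ct / cq + ct * ct\<^sup>2 / cq"
    by (simp add: field_simps power2_eq_square)
  also have "sm (ct / cq + ct * ct\<^sup>2 / cq) (K * K) - sm (ct\<^sup>2 / cq\<^sup>2) (K * K * K * K) - sm (ct\<^sup>2) 1 =
      \<theta> ((rscalar (- t\<^sup>2) + X) * (1 - X))"
    by (simp add: \<theta>_simps cnorm distrib_left distrib_right left_diff_distrib right_diff_distrib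
        sm_left_distrib power2_eq_square mult_ac)
  finally show ?thesis .
qed

text \<open>Only the relation between \<open>Z\<close> and \<open>X\<close> yields a new adjoint:
  those for \<open>Z * Z'\<close> and \<open>Z' * Z\<close> are self-adjoint, and the two for the
  inverse of \<open>X\<close> are exchanged.\<close>

lemma adj_patch_rels:
  assumes "r \<in> patch_rels (q\<^sup>2) (- t\<^sup>2)"
  shows "adj patch_bar r \<in> insert (X * Z' - Z' * (X * rscalar (q\<^sup>2))) (patch_rels (q\<^sup>2) (- t\<^sup>2))"
proof -
  have "adj patch_bar (Z * X - rscalar (q\<^sup>2) * X * Z) = X * Z' - Z' * (X * rscalar (q\<^sup>2))"
    by (simp add: adj_simps)
  moreover have "adj patch_bar (Z * Z' - (rscalar (- t\<^sup>2) + rscalar (q\<^sup>2) * X) * (1 - rscalar (q\<^sup>2) * X)) =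
      Z * Z' - (rscalar (- t\<^sup>2) + rscalar (q\<^sup>2) * X) * (1 - rscalar (q\<^sup>2) * X)"
    by (simp add: adj_simps cnorm algebra_simps)
  moreover have "adj patch_bar (Z' * Z - (rscalar (- t\<^sup>2) + X) * (1 - X)) =
      Z' * Z - (rscalar (- t\<^sup>2) + X) * (1 - X)"
    by (simp add: adj_simps cnorm algebra_simps)
  moreover have "adj patch_bar (X * Y - 1) = Y * X - 1" "adj patch_bar (Y * X - 1) = X * Y - 1"
    by (simp_all add: adj_simps)
  ultimately show ?thesis
    using assms unfolding patch_rels_def podles_rels_def by (elim UnE insertE emptyE) simp_all
qed

lemma \<theta>_cong: "p \<approx> r \<Longrightarrow> \<theta> p \<simeq>\<^sub>U \<theta> r"
proof -
  have XY: "\<theta> (X * Y) \<simeq>\<^sub>U \<theta> 1" and YX: "\<theta> (Y * X) \<simeq>\<^sub>U \<theta> 1"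
    using KKLL LLKK by (simp_all add: \<theta>_simps cnorm)
  have rels: "\<theta> r \<simeq>\<^sub>U 0" if "r \<in> patch_rels (q\<^sup>2) (- t\<^sup>2)" for r
  proof -
    from that consider "r = Z * X - rscalar (q\<^sup>2) * X * Z"
      | "r = Z * Z' - (rscalar (- t\<^sup>2) + rscalar (q\<^sup>2) * X) * (1 - rscalar (q\<^sup>2) * X)"
      | "r = Z' * Z - (rscalar (- t\<^sup>2) + X) * (1 - X)"
      | "r = X * Y - 1" | "r = Y * X - 1"
      by (auto simp: patch_rels_def podles_rels_def)
    then show ?thesis
      by cases (simp_all only: \<theta>_simps(4) pcong_0_iff \<theta>_ZX \<theta>_ZZ' \<theta>_Z'Z XY YX)
  qed
  have "\<theta> a \<simeq>\<^sub>U 0" if "a \<in> star_ideal patch_bar (patch_rels (q\<^sup>2) (- t\<^sup>2))" for a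
    using that
  proof (induction rule: star_ideal_induct)
    case (adj_rel r)
    then have "adj patch_bar r \<in> insert (X * Z' - Z' * (X * rscalar (q\<^sup>2))) (patch_rels (q\<^sup>2) (- t\<^sup>2))"
      by (rule adj_patch_rels)
    then show ?case
    proof
      assume "adj patch_bar r = X * Z' - Z' * (X * rscalar (q\<^sup>2))"
      then show ?thesis by (simp only: \<theta>_simps(4) pcong_0_iff \<theta>_XZ')
    qed (rule rels)
  next
    case (add p r)
    then show ?case using pcong_add[of _ _ "\<theta> p" 0 "\<theta> r" 0] by (simp add: \<theta>_simps)
  next
    case (mult p a b)
    then show ?case using pcong_ctx[of _ _ "\<theta> p" 0 "\<theta> a" "\<theta> b"] by (simp add: \<theta>_simps)
  qed (simp_all add: \<theta>_simps rels)
  from this[of "p - r"] show "p \<approx> r \<Longrightarrow> \<theta> p \<simeq>\<^sub>U \<theta> r"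
    by (simp add: pcong_def \<theta>_simps)
qed

section \<open>The matrix representation\<close>

abbreviation mat_cong (infix "\<simeq>\<^sub>M" 50) where
  "m \<simeq>\<^sub>M n \<equiv> mat2_cong patch_bar (patch_rels (q\<^sup>2) (- t\<^sup>2)) m n"

text \<open>The rows are the images of 1 and K under right multiplication on A + A K, where K^2 = q
  t^-1 x. They are found from \<open>L\<close> = t q^-1 \<open>Y * K\<close>, \<open>E\<close> =
  \<alpha>^-1 \<open>Z' * L\<close>, \<open>F\<close> = \<alpha>^-1 \<open>L * Z\<close> and
  \<open>K * Z\<close> = q^-1 \<open>Z * K\<close>. All four matrices are antidiagonal, so even
  elements become diagonal.\<close>

fun \<psi>_gen :: "uq_gen \<Rightarrow> patch_gen free mat2" where
  "\<psi>_gen UK = Mat2 0 1 (sm (cq / ct) X) 0"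
| "\<psi>_gen UKinv = Mat2 0 (sm (ct / cq) Y) 1 0"
| "\<psi>_gen UXp = Mat2 0 (sm (ct / (\<alpha> * cq)) (Z' * Y)) (sm (cq / \<alpha>) Z') 0"
| "\<psi>_gen UXm = Mat2 0 (sm (ct / (\<alpha> * cq\<^sup>2)) (Y * Z)) (sm (1 / \<alpha>) Z) 0"

definition "\<psi> = mat2_lift.lift \<psi>_gen"

lemma \<psi>_simps:
  "\<psi> 0 = 0" "\<psi> 1 = 1" "\<psi> (p + r) = \<psi> p + \<psi> r" "\<psi> (p - r) = \<psi> p - \<psi> r" "\<psi> (p * r) = \<psi> p * \<psi> r"
  "\<psi> (scalar c) = diag_scalar c" "\<psi> (gen g) = \<psi>_gen g"
  by (simp_all add: \<psi>_def mat2_lift.lift_simps)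

lemma diag_scalar_times: "diag_scalar c * Mat2 a b d e = Mat2 (sm c a) (sm c b) (sm c d) (sm c e)"
  by (simp add: diag_scalar_def sm_def)

lemma diag_scalar_eq: "diag_scalar c = Mat2 (sm c 1) 0 0 (sm c 1)"
  by (simp add: diag_scalar_def sm_def)

lemma \<psi>_sm: "\<psi> (sm c p) = diag_scalar c * \<psi> p"
  by (simp add: sm_def \<psi>_simps)

lemma times_diag_scalar: "Mat2 a b d e * diag_scalar c = Mat2 (sm c a) (sm c b) (sm c d) (sm c e)"
  by (simp add: diag_scalar_def sm_def scalar_central)

lemmas mnorm = \<psi>_simps \<psi>_sm diag_scalar_times times_diag_scalar one_mat2_def sm_simps mult_ac
  power2_eq_square[of cq] power3_eq_cube[of cq]

section \<open>Monomials of the patch that occur as matrix entries\<close>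

lemma Z'YX: "Z' * Y * X \<approx> Z'"
  using pcong_ctx[OF YX, of Z' 1] by (simp add: cnorm)

lemma XYZ: "X * Y * Z \<approx> Z"
  using pcong_ctx[OF XY, of 1 Z] by (simp add: cnorm)

lemma XZ'Y: "X * Z' * Y \<approx> sm (cq\<^sup>2) Z'"
  using pcong_trans[OF pcong_ctx[OF XZ', of 1 Y]] pcong_sm[OF pcong_ctx[OF XY, of Z' 1]]
  by (simp add: cnorm)

lemma YZX: "Y * Z * X \<approx> sm (cq\<^sup>2) Z"
  using pcong_trans[OF pcong_ctx[OF ZX, of Y 1]] pcong_sm[OF pcong_ctx[OF YX, of 1 Z]]
  by (simp add: cnorm)

lemma Z'YZ: "Z' * Y * Z \<approx> sm (cq\<^sup>2) (sm (- ct\<^sup>2) Y + sm (1 + ct\<^sup>2) 1 - X)"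
proof -
  have "Z' * Y * Z \<approx> sm (cq\<^sup>2) (Z' * Z * Y)"
    using pcong_ctx[OF YZ, of Z' 1] by (simp add: cnorm)
  also have "\<dots> \<approx> sm (cq\<^sup>2) ((sm (- ct\<^sup>2) 1 + sm (1 + ct\<^sup>2) X - X * X) * Y)"
    by (intro pcong_sm pcong_mult Z'Z pcong_refl)
  also have "\<dots> = sm (cq\<^sup>2) (sm (- ct\<^sup>2) Y + sm (1 + ct\<^sup>2) (X * Y) - X * (X * Y))"
    by (simp add: cnorm distrib_right left_diff_distrib)
  also have "\<dots> \<approx> sm (cq\<^sup>2) (sm (- ct\<^sup>2) Y + sm (1 + ct\<^sup>2) 1 - X * 1)"
    by (intro pcong_sm pcong_diff pcong_add pcong_mult XY pcong_refl)
  finally show ?thesis by simp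
qed

lemma ZZ'Y: "Z * Z' * Y \<approx> sm (- ct\<^sup>2) Y + sm (cq\<^sup>2 * (1 + ct\<^sup>2)) 1 - sm (cq ^ 4) X"
proof -
  have "Z * Z' * Y \<approx> (sm (- ct\<^sup>2) 1 + sm (cq\<^sup>2 * (1 + ct\<^sup>2)) X - sm (cq ^ 4) (X * X)) * Y"
    by (intro pcong_mult ZZ' pcong_refl)
  also have "\<dots> = sm (- ct\<^sup>2) Y + sm (cq\<^sup>2 * (1 + ct\<^sup>2)) (X * Y) - sm (cq ^ 4) (X * (X * Y))"
    by (simp add: cnorm distrib_right left_diff_distrib)
  also have "\<dots> \<approx> sm (- ct\<^sup>2) Y + sm (cq\<^sup>2 * (1 + ct\<^sup>2)) 1 - sm (cq ^ 4) (X * 1)"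
    by (intro pcong_sm pcong_diff pcong_add pcong_mult XY pcong_refl)
  finally show ?thesis by simp
qed

lemma YZZ': "Y * Z * Z' \<approx> sm (- ct\<^sup>2) Y + sm (cq\<^sup>2 * (1 + ct\<^sup>2)) 1 - sm (cq ^ 4) X"
proof -
  have "Y * Z * Z' \<approx> Y * (sm (- ct\<^sup>2) 1 + sm (cq\<^sup>2 * (1 + ct\<^sup>2)) X - sm (cq ^ 4) (X * X))"
    unfolding mult.assoc by (intro pcong_mult ZZ' pcong_refl)
  also have "\<dots> = sm (- ct\<^sup>2) Y + sm (cq\<^sup>2 * (1 + ct\<^sup>2)) (Y * X) - sm (cq ^ 4) (Y * X * X)"
    by (simp add: cnorm distrib_left right_diff_distrib)
  also have "\<dots> \<approx> sm (- ct\<^sup>2) Y + sm (cq\<^sup>2 * (1 + ct\<^sup>2)) 1 - sm (cq ^ 4) (1 * X)"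
    by (intro pcong_sm pcong_diff pcong_add pcong_mult YX pcong_refl)
  finally show ?thesis by simp
qed

section \<open>The relations of U_q(su_2) under \<open>\<psi>\<close>\<close>

lemma \<psi>_KL: "\<psi> (K * L) \<simeq>\<^sub>M \<psi> 1" and \<psi>_LK: "\<psi> (L * K) \<simeq>\<^sub>M \<psi> 1"
  using XY YX by (simp_all add: mnorm)

lemma \<psi>_KEL: "\<psi> (K * E * L) \<simeq>\<^sub>M \<psi> (rscalar q * E)"
  using pcong_sm[OF XZ'Y, of "1 / \<alpha>"] by (simp add: mnorm)

text \<open>The adjoint of the relation in \<open>\<psi>_KEL\<close>. The matrices carry no
  involution, so adjoint relations are checked separately.\<close>

lemma \<psi>_LFK: "\<psi> (L * F * K) \<simeq>\<^sub>M \<psi> (F * rscalar q)"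
  using pcong_sm[OF YZX, of "1 / (\<alpha> * cq)"] by (simp add: mnorm)

lemma \<psi>_KFL: "\<psi> (K * F * L) \<simeq>\<^sub>M \<psi> (rscalar (1 / q) * F)"
  using pcong_sm[OF XYZ, of "1 / (\<alpha> * cq)"] pcong_sm[OF pcong_sym[OF YZ], of "ct / (\<alpha> * cq ^ 3)"]
  by (simp add: mnorm)

lemma \<psi>_LEK: "\<psi> (L * E * K) \<simeq>\<^sub>M \<psi> (E * rscalar (1 / q))"
  using pcong_sm[OF Z'YX, of "1 / \<alpha>"] pcong_sm[OF pcong_sym[OF Z'Y], of "ct / (\<alpha> * cq\<^sup>2)"]
  by (simp add: mnorm)

text \<open>\<open>ef\<close> and \<open>fe\<close> are the values that \<open>EF\<close> and
  \<open>FE\<close> give for \<open>E * F\<close> and \<open>F * E\<close> once K^2 is replaced by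
  q/t times \<open>X\<close> and K^-2 by t/q times \<open>Y\<close>.\<close>

definition "ef = sm (1 / (ct * (cq - 1 / cq)\<^sup>2)) (sm (- ct\<^sup>2) Y + sm (1 + ct\<^sup>2) 1 - X)"
definition "fe = sm (1 / (ct * cq\<^sup>2 * (cq - 1 / cq)\<^sup>2))
  (sm (- ct\<^sup>2) Y + sm (cq\<^sup>2 * (1 + ct\<^sup>2)) 1 - sm (cq ^ 4) X)"

lemma \<psi>_EF: "\<psi> (E * F) \<simeq>\<^sub>M Mat2 ef 0 0 ef"
proof -
  have c: "ct / (\<alpha> * \<alpha> * cq) * cq\<^sup>2 = 1 / (ct * (cq - 1 / cq)\<^sup>2)"
  proof -
    \<comment> \<open>A variable \<open>m\<close> stands for q - 1/q, so that it is not expanded.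
      For \<open>m = 0\<close> both sides are 0 by the convention on division.\<close>
    have "ct / (ct\<^sup>2 * cq * m\<^sup>2 * cq) * cq\<^sup>2 = 1 / (ct * m\<^sup>2)" for m
      by (simp add: power2_eq_square)
    then show ?thesis unfolding \<alpha>_\<alpha> .
  qed
  have "\<psi> (E * F) = Mat2 (sm (ct / (\<alpha> * \<alpha> * cq)) (Z' * Y * Z)) 0 0 (sm (ct / (\<alpha> * \<alpha> * cq)) (Z' * Y * Z))"
    by (simp add: mnorm)
  then show ?thesis
    using pcong_sm_mult[OF Z'YZ c] by (simp add: ef_def)
qed

lemma \<psi>_FE: "\<psi> (F * E) \<simeq>\<^sub>M Mat2 fe 0 0 fe"
proof -
  have c: "ct / (\<alpha> * \<alpha> * cq) = 1 / (ct * cq\<^sup>2 * (cq - 1 / cq)\<^sup>2)"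
  proof -
    have "ct / (ct\<^sup>2 * cq * m\<^sup>2 * cq) = 1 / (ct * cq\<^sup>2 * m\<^sup>2)" for m
      by (simp add: power2_eq_square)
    then show ?thesis unfolding \<alpha>_\<alpha> .
  qed
  have "\<psi> (F * E) = Mat2 (sm (ct / (\<alpha> * \<alpha> * cq)) (Y * Z * Z')) 0 0 (sm (ct / (\<alpha> * \<alpha> * cq)) (Z * Z' * Y))"
    by (simp add: mnorm)
  then show ?thesis
    using pcong_sm[OF YZZ'] pcong_sm[OF ZZ'Y] by (simp add: fe_def c)
qed

lemma \<psi>_KK: "\<psi> (K\<^sup>2) = Mat2 (sm (cq / ct) X) 0 0 (sm (cq / ct) X)"
  and \<psi>_LL: "\<psi> (L\<^sup>2) = Mat2 (sm (ct / cq) Y) 0 0 (sm (ct / cq) Y)"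
  by (simp_all add: mnorm power2_eq_square)

text \<open>The coefficients of \<open>Y\<close>, \<open>1\<close> and \<open>X\<close> are
  compared. Those of \<open>1\<close> cancel; the other two follow from q^2 = 1 + m q and its form
  1/q^2 = 1 - m/q, where m = q - 1/q.\<close>

lemma ef_fe: "ef - fe = sm (1 / (cq - 1 / cq)) (sm (cq / ct) X - sm (ct / cq) Y)"
proof -
  define m where "m = cq - 1 / cq"
  have m: "m \<noteq> 0" "cq * cq = 1 + m * cq"
    unfolding m_def by (rule cq_diff) (simp add: field_simps)
  have c: "1 / (ct * cq\<^sup>2 * m\<^sup>2) = 1 / (ct * m\<^sup>2) * (1 - m / cq)"
    using m by (simp add: m_def power2_eq_square diff_divide_distrib)
  have Y: "1 / (ct * m\<^sup>2) * (- ct\<^sup>2) - 1 / (ct * cq\<^sup>2 * m\<^sup>2) * (- ct\<^sup>2) = - (1 / m * (ct / cq))"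
    unfolding c using m(1) by (simp add: power2_eq_square right_diff_distrib left_diff_distrib)
  have one: "1 / (ct * m\<^sup>2) * (1 + ct\<^sup>2) - 1 / (ct * cq\<^sup>2 * m\<^sup>2) * (cq\<^sup>2 * (1 + ct\<^sup>2)) = 0"
    by simp
  have "1 / (ct * cq\<^sup>2 * m\<^sup>2) * cq ^ 4 = 1 / (ct * m\<^sup>2) * (cq * cq)"
    by (simp add: power2_eq_square power4_eq_xxxx)
  then have X: "1 / (ct * m\<^sup>2) - 1 / (ct * cq\<^sup>2 * m\<^sup>2) * cq ^ 4 = - (1 / m * (cq / ct))"
    unfolding m(2) using m(1) by (simp add: power2_eq_square distrib_left)
  have "ef - fe = sm (1 / (ct * m\<^sup>2) * (- ct\<^sup>2) - 1 / (ct * cq\<^sup>2 * m\<^sup>2) * (- ct\<^sup>2)) Y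
      + sm (1 / (ct * m\<^sup>2) * (1 + ct\<^sup>2) - 1 / (ct * cq\<^sup>2 * m\<^sup>2) * (cq\<^sup>2 * (1 + ct\<^sup>2))) 1
      - sm (1 / (ct * m\<^sup>2) - 1 / (ct * cq\<^sup>2 * m\<^sup>2) * cq ^ 4) X"
    unfolding ef_def fe_def m_def[symmetric] sm_left_diff_distrib sm_simps(3-5) by (simp add: algebra_simps)
  also have "\<dots> = sm (1 / m) (sm (cq / ct) X - sm (ct / cq) Y)"
    unfolding Y one X by (simp add: sm_simps)
  finally show ?thesis unfolding m_def .
qed

lemma \<psi>_commutator: "\<psi> (E * F - F * E) \<simeq>\<^sub>M \<psi> (rscalar (1 / (q - 1 / q)) * (K\<^sup>2 - L\<^sup>2))"
proof -
  have "\<psi> (E * F - F * E) \<simeq>\<^sub>M Mat2 ef 0 0 ef - Mat2 fe 0 0 fe"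
    unfolding \<psi>_simps(4) by (intro mat2_cong_diff \<psi>_EF \<psi>_FE)
  also have "\<dots> = \<psi> (rscalar (1 / (q - 1 / q)) * (K\<^sup>2 - L\<^sup>2))"
    unfolding \<psi>_simps(4-6) \<psi>_KK \<psi>_LL by (simp add: ef_fe diag_scalar_times sm_simps(9))
  finally show ?thesis .
qed

lemma \<psi>_casimir: "\<psi> (casimir q) \<simeq>\<^sub>M \<psi> (rscalar (t + 1 / t))"
proof -
  define m where "m = cq - 1 / cq"
  have m: "m \<noteq> 0" unfolding m_def by (rule cq_diff)
  have "\<psi> (casimir q) = diag_scalar (1 / cq) * \<psi> (K\<^sup>2) + diag_scalar cq * \<psi> (L\<^sup>2) + diag_scalar (m\<^sup>2) * \<psi> (E * F)"
    unfolding casimir_def \<psi>_simps(3,5,6) mult.assoc by (simp add: m_def)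
  also have "\<dots> \<simeq>\<^sub>M diag_scalar (1 / cq) * \<psi> (K\<^sup>2) + diag_scalar cq * \<psi> (L\<^sup>2) + diag_scalar (m\<^sup>2) * Mat2 ef 0 0 ef"
    by (intro mat2_cong_add mat2_cong_mult mat2_cong_refl \<psi>_EF)
  also have "\<dots> = \<psi> (rscalar (t + 1 / t))"
  proof -
    have "sm (1 / cq) (sm (cq / ct) X) + sm cq (sm (ct / cq) Y) + sm (m\<^sup>2) ef = sm (ct + 1 / ct) 1"
      using m by (simp add: ef_def sm_simps sm_left_distrib add_divide_distrib power2_eq_square[of ct] flip: m_def)
    then show ?thesis
      unfolding \<psi>_simps(6) \<psi>_KK \<psi>_LL diag_scalar_times by (simp add: diag_scalar_eq sm_simps(9))
  qed
  finally show ?thesis .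
qed

text \<open>The commutator and Casimir relations are self-adjoint because \<open>E * F\<close> and
  \<open>F * E\<close> are, and the two for the inverse of \<open>K\<close> are exchanged. New
  relations come only from conjugation by \<open>K\<close>, which the involution turns into
  conjugation by \<open>L\<close>.\<close>

lemma adj_uq_casimir_rels:
  assumes "r \<in> uq_casimir_rels q (t + 1 / t)"
  shows "adj uq_bar r \<in> {L * F * K - F * rscalar q, L * E * K - E * rscalar (1 / q)} \<union>
    uq_casimir_rels q (t + 1 / t)"
proof -
  have "adj uq_bar (K * L - 1) = L * K - 1" "adj uq_bar (L * K - 1) = K * L - 1"
    by (simp_all add: adj_simps)
  moreover have "adj uq_bar (K * E * L - rscalar q * E) = L * F * K - F * rscalar q"
    "adj uq_bar (K * F * L - rscalar (1 / q) * F) = L * E * K - E * rscalar (1 / q)"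
    by (simp_all add: adj_simps mult.assoc)
  moreover have "adj uq_bar (E * F - F * E - rscalar (1 / (q - 1 / q)) * (K\<^sup>2 - L\<^sup>2)) =
      E * F - F * E - rscalar (1 / (q - 1 / q)) * (K\<^sup>2 - L\<^sup>2)"
    by (simp add: adj_simps cnorm power2_eq_square[of K] power2_eq_square[of L])
  moreover have "adj uq_bar (casimir q - rscalar (t + 1 / t)) = casimir q - rscalar (t + 1 / t)"
    by (simp add: casimir_def adj_simps cnorm power2_eq_square[of K] power2_eq_square[of L])
  ultimately show ?thesis
    using assms unfolding uq_casimir_rels_def uq_rels_def by (elim UnE insertE emptyE) auto
qed

lemma \<psi>_cong: "p \<simeq>\<^sub>U r \<Longrightarrow> \<psi> p \<simeq>\<^sub>M \<psi> r"
proof -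
  \<comment> \<open>The instances of \<open>\<psi>_simps(4)\<close> split only the outer difference
    of each relation; the inner one of the commutator stays whole, as
    \<open>\<psi>_commutator\<close> requires.\<close>
  have rels: "\<psi> r \<simeq>\<^sub>M 0" if "r \<in> uq_casimir_rels q (t + 1 / t)" for r
    using that unfolding uq_casimir_rels_def uq_rels_def
    by (elim insertE emptyE)
      (simp_all only: \<psi>_simps(4)[of "_ * _ * _"] \<psi>_simps(4)[of _ 1] \<psi>_simps(4)[of "casimir q"]
        \<psi>_simps(4)[of "_ - _"] mat2_cong_0_iff \<psi>_KL \<psi>_LK \<psi>_KEL \<psi>_KFL \<psi>_commutator \<psi>_casimir)
  have "\<psi> a \<simeq>\<^sub>M 0" if "a \<in> star_ideal uq_bar (uq_casimir_rels q (t + 1 / t))" for a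
    using that
  proof (induction rule: star_ideal_induct)
    case (adj_rel r)
    then have "adj uq_bar r \<in> {L * F * K - F * rscalar q, L * E * K - E * rscalar (1 / q)} \<union>
        uq_casimir_rels q (t + 1 / t)"
      by (rule adj_uq_casimir_rels)
    then show ?case
    proof (elim UnE insertE emptyE)
      assume "adj uq_bar r = L * F * K - F * rscalar q"
      then show ?thesis by (simp only: \<psi>_simps(4) mat2_cong_0_iff \<psi>_LFK)
    next
      assume "adj uq_bar r = L * E * K - E * rscalar (1 / q)"
      then show ?thesis by (simp only: \<psi>_simps(4) mat2_cong_0_iff \<psi>_LEK)
    qed (rule rels)
  next
    case (add p r)
    then show ?case using mat2_cong_add[of _ _ "\<psi> p" 0 "\<psi> r" 0] by (simp add: \<psi>_simps)
  next
    case (mult p a b)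
    then show ?case
      using mat2_cong_mult[OF mat2_cong_mult[OF mat2_cong_refl[of _ _ "\<psi> a"] mult] mat2_cong_refl[of _ _ "\<psi> b"]]
      by (simp add: \<psi>_simps)
  qed (simp_all add: \<psi>_simps rels mat2_cong_refl)
  from this[of "p - r"] show "p \<simeq>\<^sub>U r \<Longrightarrow> \<psi> p \<simeq>\<^sub>M \<psi> r"
    by (simp add: pcong_def \<psi>_simps mat2_cong_0_iff)
qed

text \<open>The upper left entry describes how \<open>p\<close> multiplies the basis vector 1 from
  the right, which returns \<open>p\<close>. The lower right entry is \<open>p\<close> conjugated by
  K; only its existence is recorded.\<close>

lemma \<psi>_\<theta>: "\<exists>a d. \<psi> (\<theta> p) = Mat2 a 0 0 d \<and> a \<approx> p"
proof (induction p rule: free_induct)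
  case (scalar c)
  show ?case by (simp add: \<theta>_simps \<psi>_simps diag_scalar_def)
next
  case (gen g)
  \<comment> \<open>For \<open>TZstar\<close> the entry comes out as \<open>Z' * Y * X\<close>; for
    the other generators it equals the generator itself.\<close>
  have "Z' * Y * X \<approx> Z'" by (rule Z'YX)
  then show ?case by (cases g) (simp_all add: \<theta>_simps mnorm)
next
  case (add p r)
  then show ?case by (auto simp: \<theta>_simps \<psi>_simps intro: pcong_add)
next
  case (mult p r)
  then show ?case by (auto simp: \<theta>_simps \<psi>_simps intro: pcong_mult)
qed

lemma \<theta>_inj:
  assumes "\<theta> p \<simeq>\<^sub>U \<theta> r"
  shows "p \<approx> r"
proof -
  obtain a d b e where p: "\<psi> (\<theta> p) = Mat2 a 0 0 d" "a \<approx> p" and r: "\<psi> (\<theta> r) = Mat2 b 0 0 e" "b \<approx> r"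
    using \<psi>_\<theta> by metis
  have "a \<approx> b" using \<psi>_cong[OF assms] by (simp add: p r)
  then show ?thesis using p r by (meson pcong_sym pcong_trans)
qed

section \<open>The image\<close>

lemma \<theta>_even: "cls uq_bar (uq_casimir_rels q (t + 1 / t)) (\<theta> (gen g))
    \<in> carrier (even_part uq_bar (uq_casimir_rels q (t + 1 / t)))"
  by (cases g) (simp_all add: \<theta>_simps sm_def even_part_mult even_part_scalar even_part_gens)

definition in_image :: "uq_gen free \<Rightarrow> bool" where
  "in_image p \<longleftrightarrow> (\<exists>a. p \<simeq>\<^sub>U \<theta> a)"

lemma in_image_cong: "p \<simeq>\<^sub>U r \<Longrightarrow> in_image r \<Longrightarrow> in_image p"
  unfolding in_image_def by (blast intro: pcong_trans)

lemma in_image_mult: "in_image p \<Longrightarrow> in_image r \<Longrightarrow> in_image (p * r)"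
  unfolding in_image_def by (metis \<theta>_simps(5) pcong_mult)

lemma in_image_sm: "in_image p \<Longrightarrow> in_image (sm c p)"
  unfolding in_image_def by (metis \<theta>_simps(7) pcong_sm)

lemma in_image_sm_iff: "c \<noteq> 0 \<Longrightarrow> in_image (sm c p) \<longleftrightarrow> in_image p"
  using in_image_sm[of "sm c p" "1 / c"] in_image_sm[of p c] by (auto simp: sm_simps)

lemma in_image_gens: "in_image (K * K)" "in_image (L * L)" "in_image (K * F)" "in_image (E * K)"
  and in_image_1: "in_image 1"
proof -
  have "in_image (\<theta> p)" for p
    unfolding in_image_def by (metis pcong_refl)
  from this[of X] this[of Y] this[of Z] this[of Z'] this[of 1]
  show "in_image (K * K)" "in_image (L * L)" "in_image (K * F)" "in_image (E * K)" "in_image 1"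
    by (simp_all add: \<theta>_simps in_image_sm_iff)
qed

text \<open>Inserting \<open>K\<close> and \<open>L\<close> turns a product of generators
  \<open>g\<close> and \<open>h\<close> into \<open>(g * K) * (L * L) * (K * h)\<close>. It
  therefore suffices to multiply each generator by \<open>K\<close> on either side, and the
  commutation rules reduce these products to 1 and the images of the generators of the
  patch.\<close>

lemma in_image_gen_gen: "in_image (gen g * gen h)"
proof -
  have im_KL: "in_image (K * L)" and im_LK: "in_image (L * K)"
    by (rule in_image_cong[OF _ in_image_1], rule KL LK)+
  have im_KE: "in_image (K * E)"
    by (rule in_image_cong[OF KE in_image_sm[OF in_image_gens(4)]])
  have "in_image (sm (1 / cq) (F * K))"
    by (rule in_image_cong[OF pcong_sym[OF KF] in_image_gens(3)])
  then have im_FK: "in_image (F * K)" by (simp add: in_image_sm_iff)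
  have ins_KL: "p * r \<simeq>\<^sub>U (p * K) * (L * r)" and ins_LK: "p * r \<simeq>\<^sub>U (p * L) * (K * r)" for p r
    using pcong_sym[OF pcong_ctx[OF KL, of p r]] pcong_sym[OF pcong_ctx[OF LK, of p r]]
    by (simp_all add: mult.assoc)
  have shift_l: "in_image (L * p)" if "in_image (K * p)" for p
    by (rule in_image_cong[OF ins_LK in_image_mult[OF in_image_gens(2) that]])
  have comp: "in_image (p * r)" if "in_image (p * K)" "in_image (K * r)" for p r
    by (rule in_image_cong[OF ins_KL in_image_mult[OF that(1) shift_l[OF that(2)]]])
  have right_K: "in_image (gen k * K)" and left_K: "in_image (K * gen k)" for k
    by (cases k; simp add: im_KL im_LK im_KE im_FK in_image_gens)+
  show ?thesis by (rule comp[OF right_K left_K])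
qed

end

text \<open>The involution is compared for q > 0, where \<alpha> can be chosen real. For q < 0 its
  square is negative, and the isomorphism is one of algebras.\<close>

theorem proposition3:
  fixes q t :: real
  assumes "q \<noteq> 0" and "q \<noteq> 1" and "q - 1 / q \<noteq> 0" and "t \<noteq> 0"
  shows "alg_iso (podles_patch (q\<^sup>2) (- t\<^sup>2)) (uq_su2_casimir_even q (t + 1 / t)) \<noteq> {} \<and>
    (q > 0 \<longrightarrow>
      star_alg_iso (podles_patch (q\<^sup>2) (- t\<^sup>2)) (uq_su2_casimir_even q (t + 1 / t)) \<noteq> {})"
proof -
  \<comment> \<open>The real square root for q > 0 makes \<open>cnj \<alpha> = \<alpha>\<close>
    immediate; the complex one covers q < 0.\<close>
  define \<alpha> where "\<alpha> = (if q > 0 then complex_of_real (sqrt (t\<^sup>2 * q * (q - 1 / q)\<^sup>2))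
    else csqrt (complex_of_real (t\<^sup>2 * q * (q - 1 / q)\<^sup>2)))"
  have "\<alpha>\<^sup>2 = complex_of_real (t\<^sup>2 * q * (q - 1 / q)\<^sup>2)"
  proof (cases "q > 0")
    case True
    then have "(sqrt (t\<^sup>2 * q * (q - 1 / q)\<^sup>2))\<^sup>2 = t\<^sup>2 * q * (q - 1 / q)\<^sup>2"
      by (intro real_sqrt_pow2) simp
    with True show ?thesis by (simp only: \<alpha>_def if_True of_real_power[symmetric])
  qed (simp only: \<alpha>_def if_False power2_csqrt)
  then interpret podles_uq q t \<alpha>
    using assms by unfold_locales
  have inv: "patch_bar (patch_bar g) = g" "uq_bar (uq_bar h) = h" for g h
    by (cases g; simp) (cases h; simp)
  let ?A = "presented patch_bar (patch_rels (q\<^sup>2) (- t\<^sup>2))"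
  let ?B = "even_part uq_bar (uq_casimir_rels q (t + 1 / t))"
  obtain f where f: "f \<in> alg_iso ?A ?B"
    and f_cls: "\<And>p. f (cls patch_bar (patch_rels (q\<^sup>2) (- t\<^sup>2)) p) =
      cls uq_bar (uq_casimir_rels q (t + 1 / t)) (\<theta> p)"
    by (rule induced_iso[OF \<theta>_simps(3,5,6) \<theta>_cong \<theta>_inj \<theta>_even in_image_gen_gen[unfolded in_image_def]])
      (assumption | rule that)+
  have "f \<in> star_alg_iso ?A ?B"
    if "q > 0"
  proof -
    have "cnj \<alpha> = \<alpha>" using that by (simp only: \<alpha>_def if_True complex_cnj_complex_of_real)
    \<comment> \<open>Both sides are antilinear and reverse products, so they need to agree only on
      generators.\<close>
    then have "\<theta> (adj patch_bar p) = adj uq_bar (\<theta> p)" for p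
    proof (induction p rule: free_induct)
      case (gen g)
      then show ?case by (cases g) (simp_all add: \<theta>_simps adj_simps)
    qed (simp_all only: \<theta>_simps adj_simps)
    then show ?thesis
      by (rule alg_iso_imp_star_alg_iso[of f patch_bar _ uq_bar _ \<theta>, OF f f_cls inv])
  qed
  with f show ?thesis
    unfolding podles_patch_def uq_su2_casimir_even_def by blast
qed

end
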